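(* Let $\mathcal{G},\mathcal{H}$ be condensed groups and $\mathcal{X}$ a $\mathcal{G}$-$\mathcal{H}$-biset such that the left $\mathcal{G}$-action on $\mathcal{X}$ is open (or the right $\mathcal{H}$-action on $\mathcal{X}$ is open). Then the quotient set $\mathcal{G}\backslash\mathcal{X}/\mathcal{H}$ is discrete. Moreover, there is an isomorphism of $\mathcal{G}$-$\mathcal{H}$-bisets $$\mathcal{X}\cong\coprod_{x\in(\mathcal{G}\backslash\mathcal{X}/\mathcal{H})( * )}\mathcal{G}x\mathcal{H},$$ which decomposes $\mathcal{X}$ into its double orbits.
   Context: Set-theoretic issues are ignored. A condensed set/group is a sheaf of sets/groups on the category $\mathbf{CHED}$ of compact Hausdorff extremally disconnected spaces, with finite jointly surjective families as covers; equivalently a contravariant functor $\mathcal{T}$ with $\mathcal{T}(\varnothing)=*$ and $\mathcal{T}(S_1\sqcup S_2)\cong\mathcal{T}(S_1)\times\mathcal{T}(S_2)$. For a ($T1$) topological space $T$, $\underline{T}=C(-,T)$ is the associated condensed set. $\mathcal{T}( * )$ is the underlying set/group. A condensed set $\mathcal{Y}$ is discrete if $\mathcal{Y}=\underline{\mathcal{Y}( * )}$ (canonically), where $\mathcal{Y}( * )$ has the discrete topology. A left $\mathcal{G}$-set is a condensed set $\mathcal{X}$ with a natural transformation $\mathcal{G}\times\mathcal{X}\to\mathcal{X}$ making each $\mathcal{X}(S)$ a left $\mathcal{G}(S)$-set; right $\mathcal{H}$-sets are defined similarly. A $\mathcal{G}$-$\mathcal{H}$-biset is a condensed set that is a left $\mathcal{G}$-set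 and a right $\mathcal{H}$-set with commuting actions. Quotients are defined pointwise (these are sheaves): $(\mathcal{G}\backslash\mathcal{X})(S)=\mathcal{G}(S)\backslash\mathcal{X}(S)$ and $(\mathcal{G}\backslash\mathcal{X}/\mathcal{H})(S)=\mathcal{G}(S)\backslash\mathcal{X}(S)/\mathcal{H}(S)$. For $x\in(\mathcal{G}\backslash\mathcal{X})( * )$, the orbit $\mathcal{G}x\subseteq\mathcal{X}$ is the pullback of $\mathcal{X}\to\mathcal{G}\backslash\mathcal{X}$ along $x\colon\underline{*}\to\mathcal{G}\backslash\mathcal{X}$; for $x\in(\mathcal{G}\backslash\mathcal{X}/\mathcal{H})( * )$, the double orbit $\mathcal{G}x\mathcal{H}\subseteq\mathcal{X}$ is the pullback of $\mathcal{X}\to\mathcal{G}\backslash\mathcal{X}/\mathcal{H}$ along $x$. The left $\mathcal{G}$-action on $\mathcal{X}$ is open if for every $S\in\mathbf{CHED}$, every map $\underline{S}\to\mathcal{X}$ and every $x\in(\mathcal{G}\backslash\mathcal{X})( * )$, the pullback $\underline{S}\times_{\mathcal{X}}\mathcal{G}x$ is representable by an open subset of $S$ (i.e. equals $\underline{P}$ for some open $P\subseteq S$); open right actions are defined similarly. Coproducts are taken in condensed sets. *)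

theory Defs
  imports "HOL-Analysis.Analysis" "HOL-Algebra.Group_Action"
begin

section \<open>Condensed sets\<close>

text \<open>
  The site: compact Hausdorff extremally disconnected spaces whose points are taken from a type
  \<open>'p\<close>. Size issues are thus settled by the choice of the universe \<open>'p\<close>, which stays arbitrary.
\<close>

definition ched :: "'p topology \<Rightarrow> bool" where
  "ched S \<longleftrightarrow> compact_space S \<and> Hausdorff_space S \<and>
     (\<forall>U. openin S U \<longrightarrow> openin S (S closure_of U))"

definition pt :: "'p topology" where
  "pt = discrete_topology {undefined}"

text \<open>
  \<open>res X S T f\<close> is the map \<open>X(f) : X(T) \<rightarrow> X(S)\<close> of a contravariant functor for \<open>f : S \<rightarrow> T\<close>.
  A morphism \<open>S \<rightarrow> T\<close> is a continuous map up to equality on \<open>topspace S\<close>; hence the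
  congruence condition in \<open>presheaf\<close>.
\<close>

record ('p, 'x) cset =
  sect :: "'p topology \<Rightarrow> 'x set"
  res :: "'p topology \<Rightarrow> 'p topology \<Rightarrow> ('p \<Rightarrow> 'p) \<Rightarrow> 'x \<Rightarrow> 'x"

definition presheaf :: "('p, 'x) cset \<Rightarrow> bool" where
  "presheaf X \<longleftrightarrow>
     (\<forall>S T f. ched S \<and> ched T \<and> continuous_map S T f \<longrightarrow> res X S T f \<in> sect X T \<rightarrow> sect X S) \<and>
     (\<forall>S T f g. ched S \<and> ched T \<and> continuous_map S T f \<and> continuous_map S T g \<and>
        (\<forall>s\<in>topspace S. f s = g s) \<longrightarrow> (\<forall>x\<in>sect X T. res X S T f x = res X S T g x)) \<and>
     (\<forall>S. ched S \<longrightarrow> (\<forall>x\<in>sect X S. res X S S id x = x)) \<and>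
     (\<forall>R S T f g. ched R \<and> ched S \<and> ched T \<and> continuous_map R S f \<and> continuous_map S T g \<longrightarrow>
        (\<forall>x\<in>sect X T. res X R T (g \<circ> f) x = res X R S f (res X S T g x)))"

text \<open>
  The sheaf condition, as \<open>X(\<emptyset>) = *\<close> and \<open>X(S\<^sub>1 \<squnion> S\<^sub>2) = X(S\<^sub>1) \<times> X(S\<^sub>2)\<close>. A space that is a disjoint
  union of \<open>S\<^sub>1\<close> and \<open>S\<^sub>2\<close> is the same as a space \<open>S\<close> with a clopen subset \<open>U\<close> (homeomorphic to \<open>S\<^sub>1\<close>,
  its complement being homeomorphic to \<open>S\<^sub>2\<close>).
\<close>

definition condensed_set :: "('p, 'x) cset \<Rightarrow> bool" where
  "condensed_set X \<longleftrightarrow> presheaf X \<and>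
     (\<exists>!x. x \<in> sect X trivial_topology) \<and>
     (\<forall>S U. ched S \<and> openin S U \<and> closedin S U \<longrightarrow>
        bij_betw (\<lambda>x. (res X (subtopology S U) S id x, res X (subtopology S (topspace S - U)) S id x))
          (sect X S) (sect X (subtopology S U) \<times> sect X (subtopology S (topspace S - U))))"

text \<open>A morphism of (pre)sheaves is a natural transformation.\<close>

definition cset_hom :: "('p, 'x) cset \<Rightarrow> ('p, 'y) cset \<Rightarrow> ('p topology \<Rightarrow> 'x \<Rightarrow> 'y) \<Rightarrow> bool" where
  "cset_hom X Y \<phi> \<longleftrightarrow>
     (\<forall>S. ched S \<longrightarrow> \<phi> S \<in> sect X S \<rightarrow> sect Y S) \<and>
     (\<forall>S T f. ched S \<and> ched T \<and> continuous_map S T f \<longrightarrow>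
        (\<forall>x\<in>sect X T. \<phi> S (res X S T f x) = res Y S T f (\<phi> T x)))"

definition cset_iso :: "('p, 'x) cset \<Rightarrow> ('p, 'y) cset \<Rightarrow> ('p topology \<Rightarrow> 'x \<Rightarrow> 'y) \<Rightarrow> bool" where
  "cset_iso X Y \<phi> \<longleftrightarrow> cset_hom X Y \<phi> \<and> (\<forall>S. ched S \<longrightarrow> bij_betw (\<phi> S) (sect X S) (sect Y S))"

text \<open>The functor \<open>C(-, T)\<close>; continuous maps are made extensional so that morphisms are counted once.\<close>

definition underline :: "'t topology \<Rightarrow> ('p, 'p \<Rightarrow> 't) cset" where
  "underline T = \<lparr>
     sect = \<lambda>S. {f. continuous_map S T f \<and> f \<in> extensional (topspace S)},
     res = \<lambda>R S g f. restrict (f \<circ> g) (topspace R) \<rparr>"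

text \<open>
  The canonical comparison between \<open>Y\<close> and \<open>C(-, Y(*))\<close> sends \<open>y \<in> Y(S)\<close> to the
  function that maps a point \<open>s\<close>, viewed as \<open>* \<rightarrow> S\<close>, to the pullback of \<open>y\<close> along it. (On locally
  constant functions it is inverse to the map \<open>C(-, Y(*)) \<rightarrow> Y\<close> adjoint to the
  identity of \<open>Y(*)\<close>.)
\<close>

definition eval_points :: "('p, 'y) cset \<Rightarrow> 'p topology \<Rightarrow> 'y \<Rightarrow> ('p \<Rightarrow> 'y)" where
  "eval_points Y S y = (\<lambda>s\<in>topspace S. res Y pt S (\<lambda>_. s) y)"

definition discrete_cset :: "('p, 'y) cset \<Rightarrow> bool" where
  "discrete_cset Y \<longleftrightarrow> condensed_set Y \<and>
     cset_iso Y (underline (discrete_topology (sect Y pt))) (eval_points Y)"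


section \<open>Condensed groups and bisets\<close>

record ('p, 'g) cgroup =
  grp :: "'p topology \<Rightarrow> 'g monoid"
  gres :: "'p topology \<Rightarrow> 'p topology \<Rightarrow> ('p \<Rightarrow> 'p) \<Rightarrow> 'g \<Rightarrow> 'g"

definition cset_of_cgroup :: "('p, 'g) cgroup \<Rightarrow> ('p, 'g) cset" where
  "cset_of_cgroup G = \<lparr> sect = \<lambda>S. carrier (grp G S), res = gres G \<rparr>"

definition condensed_group :: "('p, 'g) cgroup \<Rightarrow> bool" where
  "condensed_group G \<longleftrightarrow> condensed_set (cset_of_cgroup G) \<and>
     (\<forall>S. ched S \<longrightarrow> group (grp G S)) \<and>
     (\<forall>S T f. ched S \<and> ched T \<and> continuous_map S T f \<longrightarrow> gres G S T f \<in> hom (grp G T) (grp G S))"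

text \<open>
  The locale \<open>group_action\<close> of the library only covers left actions and requires the action maps to
  be extensional, so both kinds of actions are spelled out: \<open>l S g x\<close> is \<open>g x\<close> and
  \<open>r S x h\<close> is \<open>x h\<close>.
\<close>

definition left_gset ::
  "('p, 'g) cgroup \<Rightarrow> ('p, 'x) cset \<Rightarrow> ('p topology \<Rightarrow> 'g \<Rightarrow> 'x \<Rightarrow> 'x) \<Rightarrow> bool" where
  "left_gset G X l \<longleftrightarrow> condensed_set X \<and>
     (\<forall>S. ched S \<longrightarrow>
        (\<forall>g\<in>carrier (grp G S). \<forall>x\<in>sect X S. l S g x \<in> sect X S) \<and>
        (\<forall>x\<in>sect X S. l S \<one>\<^bsub>grp G S\<^esub> x = x) \<and>
        (\<forall>g\<in>carrier (grp G S). \<forall>g'\<in>carrier (grp G S). \<forall>x\<in>sect X S.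
           l S (g \<otimes>\<^bsub>grp G S\<^esub> g') x = l S g (l S g' x))) \<and>
     (\<forall>S T f. ched S \<and> ched T \<and> continuous_map S T f \<longrightarrow>
        (\<forall>g\<in>carrier (grp G T). \<forall>x\<in>sect X T.
           res X S T f (l T g x) = l S (gres G S T f g) (res X S T f x)))"

definition right_gset ::
  "('p, 'h) cgroup \<Rightarrow> ('p, 'x) cset \<Rightarrow> ('p topology \<Rightarrow> 'x \<Rightarrow> 'h \<Rightarrow> 'x) \<Rightarrow> bool" where
  "right_gset H X r \<longleftrightarrow> condensed_set X \<and>
     (\<forall>S. ched S \<longrightarrow>
        (\<forall>h\<in>carrier (grp H S). \<forall>x\<in>sect X S. r S x h \<in> sect X S) \<and>
        (\<forall>x\<in>sect X S. r S x \<one>\<^bsub>grp H S\<^esub> = x) \<and>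
        (\<forall>h\<in>carrier (grp H S). \<forall>h'\<in>carrier (grp H S). \<forall>x\<in>sect X S.
           r S x (h \<otimes>\<^bsub>grp H S\<^esub> h') = r S (r S x h) h')) \<and>
     (\<forall>S T f. ched S \<and> ched T \<and> continuous_map S T f \<longrightarrow>
        (\<forall>h\<in>carrier (grp H T). \<forall>x\<in>sect X T.
           res X S T f (r T x h) = r S (res X S T f x) (gres H S T f h)))"

definition biset ::
  "('p, 'g) cgroup \<Rightarrow> ('p, 'h) cgroup \<Rightarrow> ('p, 'x) cset \<Rightarrow>
   ('p topology \<Rightarrow> 'g \<Rightarrow> 'x \<Rightarrow> 'x) \<Rightarrow> ('p topology \<Rightarrow> 'x \<Rightarrow> 'h \<Rightarrow> 'x) \<Rightarrow> bool" where
  "biset G H X l r \<longleftrightarrow> left_gset G X l \<and> right_gset H X r \<and>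
     (\<forall>S. ched S \<longrightarrow> (\<forall>g\<in>carrier (grp G S). \<forall>x\<in>sect X S. \<forall>h\<in>carrier (grp H S).
        r S (l S g x) h = l S g (r S x h)))"

definition biset_iso ::
  "('p, 'g) cgroup \<Rightarrow> ('p, 'h) cgroup \<Rightarrow>
   ('p, 'x) cset \<Rightarrow> ('p topology \<Rightarrow> 'g \<Rightarrow> 'x \<Rightarrow> 'x) \<Rightarrow> ('p topology \<Rightarrow> 'x \<Rightarrow> 'h \<Rightarrow> 'x) \<Rightarrow>
   ('p, 'y) cset \<Rightarrow> ('p topology \<Rightarrow> 'g \<Rightarrow> 'y \<Rightarrow> 'y) \<Rightarrow> ('p topology \<Rightarrow> 'y \<Rightarrow> 'h \<Rightarrow> 'y) \<Rightarrow>
   ('p topology \<Rightarrow> 'x \<Rightarrow> 'y) \<Rightarrow> bool" where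
  "biset_iso G H X l r Y l' r' \<phi> \<longleftrightarrow>
     biset G H X l r \<and> biset G H Y l' r' \<and> cset_iso X Y \<phi> \<and>
     (\<forall>S. ched S \<longrightarrow>
        (\<forall>g\<in>carrier (grp G S). \<forall>x\<in>sect X S. \<phi> S (l S g x) = l' S g (\<phi> S x)) \<and>
        (\<forall>h\<in>carrier (grp H S). \<forall>x\<in>sect X S. \<phi> S (r S x h) = r' S (\<phi> S x) h))"


section \<open>Quotients, orbits and openness\<close>

text \<open>
  All three quotients have the same shape: \<open>q S x\<close> is the class of \<open>x \<in> X(S)\<close>, and
  restriction sends a class to the class of the restriction of any of its members
  (the union below has only one member when \<open>q\<close> is a (double) orbit map).
\<close>

definition quotient_cset ::
  "('p, 'x) cset \<Rightarrow> ('p topology \<Rightarrow> 'x \<Rightarrow> 'x set) \<Rightarrow> ('p, 'x set) cset" where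
  "quotient_cset X q = \<lparr>
     sect = \<lambda>S. q S ` sect X S,
     res = \<lambda>S T f c. \<Union>y\<in>c. q S (res X S T f y) \<rparr>"

definition left_orbit ::
  "('p, 'g) cgroup \<Rightarrow> ('p topology \<Rightarrow> 'g \<Rightarrow> 'x \<Rightarrow> 'x) \<Rightarrow> 'p topology \<Rightarrow> 'x \<Rightarrow> 'x set" where
  "left_orbit G l S x = {l S g x |g. g \<in> carrier (grp G S)}"

definition right_orbit ::
  "('p, 'h) cgroup \<Rightarrow> ('p topology \<Rightarrow> 'x \<Rightarrow> 'h \<Rightarrow> 'x) \<Rightarrow> 'p topology \<Rightarrow> 'x \<Rightarrow> 'x set" where
  "right_orbit H r S x = {r S x h |h. h \<in> carrier (grp H S)}"

definition double_orbit ::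
  "('p, 'g) cgroup \<Rightarrow> ('p, 'h) cgroup \<Rightarrow> ('p topology \<Rightarrow> 'g \<Rightarrow> 'x \<Rightarrow> 'x) \<Rightarrow>
   ('p topology \<Rightarrow> 'x \<Rightarrow> 'h \<Rightarrow> 'x) \<Rightarrow> 'p topology \<Rightarrow> 'x \<Rightarrow> 'x set" where
  "double_orbit G H l r S x =
     {r S (l S g x) h |g h. g \<in> carrier (grp G S) \<and> h \<in> carrier (grp H S)}"

abbreviation double_quotient ::
  "('p, 'g) cgroup \<Rightarrow> ('p, 'h) cgroup \<Rightarrow> ('p, 'x) cset \<Rightarrow> ('p topology \<Rightarrow> 'g \<Rightarrow> 'x \<Rightarrow> 'x) \<Rightarrow>
   ('p topology \<Rightarrow> 'x \<Rightarrow> 'h \<Rightarrow> 'x) \<Rightarrow> ('p, 'x set) cset" where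
  "double_quotient G H X l r \<equiv> quotient_cset X (double_orbit G H l r)"

text \<open>
  The pullback of \<open>X \<rightarrow> X/q\<close> along a point \<open>c\<close> of the quotient, as a subobject of \<open>X\<close>.
  For the three orbit maps this is \<open>Gx\<close>, \<open>xH\<close> and \<open>GxH\<close>.
\<close>

definition orbit_cset ::
  "('p, 'x) cset \<Rightarrow> ('p topology \<Rightarrow> 'x \<Rightarrow> 'x set) \<Rightarrow> 'x set \<Rightarrow> ('p, 'x) cset" where
  "orbit_cset X q c = \<lparr>
     sect = \<lambda>S. {y \<in> sect X S. q S y = res (quotient_cset X q) S pt (\<lambda>_. undefined) c},
     res = res X \<rparr>"

text \<open>
  Openness of orbits: the pullback of \<open>Gx \<subseteq> X\<close> along \<open>\<phi> : C(-, S) \<rightarrow> X\<close> is formed as a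
  subobject of \<open>C(-, S)\<close>, and compared with the subobject \<open>C(-, P)\<close>.
\<close>

definition open_orbits :: "('p, 'x) cset \<Rightarrow> ('p topology \<Rightarrow> 'x \<Rightarrow> 'x set) \<Rightarrow> bool" where
  "open_orbits X q \<longleftrightarrow>
     (\<forall>(S :: 'p topology) \<phi>. ched S \<and> cset_hom (underline S) X \<phi> \<longrightarrow>
        (\<forall>c\<in>sect (quotient_cset X q) pt.
           \<exists>P. openin S P \<and>
             (\<forall>R. ched R \<longrightarrow>
                {f \<in> sect (underline S) R. \<phi> R f \<in> sect (orbit_cset X q c) R} =
                sect (underline (subtopology S P)) R)))"

definition open_left_action ::
  "('p, 'g) cgroup \<Rightarrow> ('p, 'x) cset \<Rightarrow> ('p topology \<Rightarrow> 'g \<Rightarrow> 'x \<Rightarrow> 'x) \<Rightarrow> bool" where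
  "open_left_action G X l \<longleftrightarrow> open_orbits X (left_orbit G l)"

definition open_right_action ::
  "('p, 'h) cgroup \<Rightarrow> ('p, 'x) cset \<Rightarrow> ('p topology \<Rightarrow> 'x \<Rightarrow> 'h \<Rightarrow> 'x) \<Rightarrow> bool" where
  "open_right_action H X r \<longleftrightarrow> open_orbits X (right_orbit H r)"


section \<open>Coproducts of condensed sets\<close>

text \<open>
  The coproduct in sheaves: a section over \<open>S\<close> is a locally constant map
  \<open>f : S \<rightarrow> I\<close> together with a section of \<open>Y i\<close> over each fibre \<open>f\<^sup>-\<^sup>1(i)\<close>. (All but finitely many
  fibres are empty, and there the section is unique.)
\<close>

definition fibre :: "'p topology \<Rightarrow> ('p \<Rightarrow> 'i) \<Rightarrow> 'i \<Rightarrow> 'p topology" where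
  "fibre S f i = subtopology S {s \<in> topspace S. f s = i}"

definition coprod_cset ::
  "'i set \<Rightarrow> ('i \<Rightarrow> ('p, 'x) cset) \<Rightarrow> ('p, ('p \<Rightarrow> 'i) \<times> ('i \<Rightarrow> 'x)) cset" where
  "coprod_cset I Y = \<lparr>
     sect = \<lambda>S. {(f, y). f \<in> sect (underline (discrete_topology I)) S \<and>
                         y \<in> (\<Pi>\<^sub>E i\<in>I. sect (Y i) (fibre S f i))},
     res = \<lambda>R S k (f, y).
       (res (underline (discrete_topology I)) R S k f,
        \<lambda>i\<in>I. res (Y i) (fibre R (f \<circ> k) i) (fibre S f i) k (y i)) \<rparr>"

definition coprod_inj :: "'i set \<Rightarrow> ('i \<Rightarrow> ('p, 'x) cset) \<Rightarrow> 'i \<Rightarrow> 'p topology \<Rightarrow> 'x \<Rightarrow>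
    ('p \<Rightarrow> 'i) \<times> ('i \<Rightarrow> 'x)" where
  "coprod_inj I Y j S y =
     (\<lambda>s\<in>topspace S. j,
      \<lambda>i\<in>I. if i = j then res (Y j) (fibre S (\<lambda>_. j) j) S id y
            else (THE z. z \<in> sect (Y i) trivial_topology))"

definition coprod_left ::
  "'i set \<Rightarrow> ('p, 'g) cgroup \<Rightarrow> ('p topology \<Rightarrow> 'g \<Rightarrow> 'x \<Rightarrow> 'x) \<Rightarrow>
   'p topology \<Rightarrow> 'g \<Rightarrow> ('p \<Rightarrow> 'i) \<times> ('i \<Rightarrow> 'x) \<Rightarrow> ('p \<Rightarrow> 'i) \<times> ('i \<Rightarrow> 'x)" where
  "coprod_left I G l S g = (\<lambda>(f, y).
     (f, \<lambda>i\<in>I. l (fibre S f i) (gres G (fibre S f i) S id g) (y i)))"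

definition coprod_right ::
  "'i set \<Rightarrow> ('p, 'h) cgroup \<Rightarrow> ('p topology \<Rightarrow> 'x \<Rightarrow> 'h \<Rightarrow> 'x) \<Rightarrow>
   'p topology \<Rightarrow> ('p \<Rightarrow> 'i) \<times> ('i \<Rightarrow> 'x) \<Rightarrow> 'h \<Rightarrow> ('p \<Rightarrow> 'i) \<times> ('i \<Rightarrow> 'x)" where
  "coprod_right I H r S = (\<lambda>(f, y) h.
     (f, \<lambda>i\<in>I. r (fibre S f i) (y i) (gres H (fibre S f i) S id h)))"


section \<open>The construction is the coproduct\<close>

text \<open>
  \<open>coprod_cset I Y\<close> with the maps \<open>coprod_inj I Y i\<close> has the universal property of the coproduct
  of the \<open>Y i\<close> in condensed sets: see \<open>condensed_coprod\<close>, \<open>coprod_inj_hom\<close>,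
  \<open>coprod_universal_ex\<close> and \<open>coprod_universal_unique\<close> below.
\<close>

lemma ched_subtopology:
  assumes "ched S" "openin S U" "closedin S U"
  shows "ched (subtopology S U)"
  unfolding ched_def
proof (intro conjI allI impI)
  show "compact_space (subtopology S U)"
    using assms closedin_compact_space compact_space_subtopology by (auto simp: ched_def)
  show "Hausdorff_space (subtopology S U)"
    using assms Hausdorff_space_subtopology by (auto simp: ched_def)
  fix V assume "openin (subtopology S U) V"
  then have V: "openin S V" "V \<subseteq> U"
    using assms openin_open_subtopology by blast+
  then have "openin S (S closure_of V)" using assms by (auto simp: ched_def)
  moreover have "S closure_of V \<subseteq> U" using V assms closure_of_minimal by blast
  moreover have "subtopology S U closure_of V = S closure_of V"
    using V \<open>S closure_of V \<subseteq> U\<close> closure_of_subtopology[of S U V] by (simp add: Int_absorb1 Int_absorb2)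
  ultimately show "openin (subtopology S U) (subtopology S U closure_of V)"
    using assms openin_open_subtopology by (simp add: openin_open_subtopology)
qed

lemma presheafD:
  assumes "presheaf X" "ched S" "ched T" "continuous_map S T f" "x \<in> sect X T"
  shows presheaf_res_in: "res X S T f x \<in> sect X S"
    and presheaf_res_cong: "\<And>g. continuous_map S T g \<Longrightarrow> (\<And>s. s \<in> topspace S \<Longrightarrow> f s = g s)
          \<Longrightarrow> res X S T f x = res X S T g x"
    and presheaf_res_comp: "\<And>R g. ched R \<Longrightarrow> continuous_map R S g
          \<Longrightarrow> res X R S g (res X S T f x) = res X R T (f \<circ> g) x"
proof -
  note a = assms(1)[unfolded presheaf_def]
  note a1 = conjunct1[OF a] and a2 = conjunct1[OF conjunct2[OF a]]
    and a4 = conjunct2[OF conjunct2[OF conjunct2[OF a]]]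
  show "res X S T f x \<in> sect X S"
    using a1 assms(2-5) by (simp add: Pi_iff)
  show "res X S T f x = res X S T g x"
    if "continuous_map S T g" "\<And>s. s \<in> topspace S \<Longrightarrow> f s = g s" for g
    using a2[rule_format, of S T f g x] assms(2-5) that by simp
  show "res X R S g (res X S T f x) = res X R T (f \<circ> g) x"
    if "ched R" "continuous_map R S g" for R g
    using a4[rule_format, of R S T g f x] assms(2-5) that by simp
qed

lemma presheaf_res_id:
  assumes "presheaf X" "ched S" "x \<in> sect X S"
  shows "res X S S id x = x"
proof -
  note a = assms(1)[unfolded presheaf_def]
  show ?thesis
    using conjunct1[OF conjunct2[OF conjunct2[OF a]]] assms(2,3) by simp
qed

lemma condensed_presheaf: "condensed_set X \<Longrightarrow> presheaf X"
  by (simp add: condensed_set_def)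

lemma bij_betw_obtain_ex1: "bij_betw F A B \<Longrightarrow> b \<in> B \<Longrightarrow> \<exists>!x. x \<in> A \<and> F x = b"
  by (auto simp: bij_betw_def inj_on_def)

lemma condensed_split:
  assumes "condensed_set X" "ched S" "openin S U" "closedin S U"
    and "a \<in> sect X (subtopology S U)" "b \<in> sect X (subtopology S (topspace S - U))"
  shows "\<exists>!x. x \<in> sect X S \<and> res X (subtopology S U) S id x = a
              \<and> res X (subtopology S (topspace S - U)) S id x = b"
proof -
  let ?F = "\<lambda>x. (res X (subtopology S U) S id x, res X (subtopology S (topspace S - U)) S id x)"
  have "bij_betw ?F (sect X S) (sect X (subtopology S U) \<times> sect X (subtopology S (topspace S - U)))"
    using assms unfolding condensed_set_def by blast
  then have "\<exists>!x. x \<in> sect X S \<and> ?F x = (a, b)"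
    by (rule bij_betw_obtain_ex1) (use assms(5,6) in simp)
  then show ?thesis by simp
qed

lemma condensed_trivial: "condensed_set X \<Longrightarrow> topspace S = {} \<Longrightarrow> \<exists>!x. x \<in> sect X S"
  by (simp add: condensed_set_def)

lemma continuous_sub_id [simp]: "U \<subseteq> V \<Longrightarrow> continuous_map (subtopology S U) (subtopology S V) id"
  unfolding id_def by (rule continuous_map_into_subtopology) (auto intro: continuous_map_from_subtopology)

lemma continuous_sub_id' [simp]: "continuous_map (subtopology S U) S id"
  by (simp add: continuous_map_from_subtopology)

lemma res_sub_sub:
  assumes "presheaf X" "ched S" "x \<in> sect X S" "ched (subtopology S U)" "ched (subtopology S V)" "V \<subseteq> U"
  shows "res X (subtopology S V) (subtopology S U) id (res X (subtopology S U) S id x)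
       = res X (subtopology S V) S id x"
  using presheaf_res_comp[OF assms(1,4,2) _ assms(3,5), of id id] assms(6) by simp

lemma condensed_glue_finite:
  assumes "condensed_set X" "finite J" "ched S"
    and "\<And>j. j \<in> J \<Longrightarrow> openin S (U j) \<and> closedin S (U j)"
    and "disjoint_family_on U J" "(\<Union>j\<in>J. U j) = topspace S"
    and "\<And>j. j \<in> J \<Longrightarrow> z j \<in> sect X (subtopology S (U j))"
  shows "\<exists>!w. w \<in> sect X S \<and> (\<forall>j\<in>J. res X (subtopology S (U j)) S id w = z j)"
  using assms(2-)
proof (induction J arbitrary: S rule: finite_induct)
  case empty
  then show ?case using condensed_trivial[OF assms(1), of S] by simp
next
  case (insert k J)
  note P = condensed_presheaf[OF assms(1)]
  let ?C = "topspace S - U k"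
  let ?S' = "subtopology S ?C"
  have clC: "openin S ?C" "closedin S ?C" using insert.prems(2)[of k] by auto
  then have chC: "ched ?S'" using ched_subtopology insert.prems(1) by blast
  have sub: "U j \<subseteq> ?C" if "j \<in> J" for j
    using that insert.prems(2)[of j] insert.prems(3) insert.hyps(2) openin_subset[of S "U j"]
    unfolding disjoint_family_on_def by fastforce
  have eqs: "subtopology ?S' (U j) = subtopology S (U j)" if "j \<in> J" for j
    using sub[OF that] by (simp add: subtopology_subtopology Int_absorb1)
  have chU: "ched (subtopology S (U j))" if "j \<in> insert k J" for j
    using ched_subtopology insert.prems(1,2) that by blast
  have "\<exists>!w. w \<in> sect X ?S' \<and> (\<forall>j\<in>J. res X (subtopology ?S' (U j)) ?S' id w = z j)"
  proof (rule insert.IH[OF chC])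
    show "openin ?S' (U j) \<and> closedin ?S' (U j)" if "j \<in> J" for j
      using that sub[OF that] insert.prems(2)[of j] clC
      by (simp add: openin_open_subtopology closedin_closed_subtopology)
    show "disjoint_family_on U J" using insert.prems(3) by (auto simp: disjoint_family_on_def)
    show "\<Union> (U ` J) = topspace ?S'"
      using insert.prems(4) sub by auto
    show "z j \<in> sect X (subtopology ?S' (U j))" if "j \<in> J" for j
      using insert.prems(5)[of j] that eqs by simp
  qed
  then obtain b where b0: "b \<in> sect X ?S' \<and> (\<forall>j\<in>J. res X (subtopology ?S' (U j)) ?S' id b = z j)"
    and bu0: "\<And>w. w \<in> sect X ?S' \<and> (\<forall>j\<in>J. res X (subtopology ?S' (U j)) ?S' id w = z j) \<Longrightarrow> w = b"
    by (elim ex1E) blast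
  have b: "b \<in> sect X ?S'" "\<And>j. j \<in> J \<Longrightarrow> res X (subtopology S (U j)) ?S' id b = z j"
    using b0 eqs by auto
  have bu: "w = b" if "w \<in> sect X ?S'" "\<forall>j\<in>J. res X (subtopology S (U j)) ?S' id w = z j" for w
    by (rule bu0) (use that eqs in auto)
  have key: "(\<forall>j\<in>J. res X (subtopology S (U j)) S id w = z j) \<longleftrightarrow> res X ?S' S id w = b"
    if w: "w \<in> sect X S" for w
  proof -
    have e: "res X (subtopology S (U j)) ?S' id (res X ?S' S id w) = res X (subtopology S (U j)) S id w"
      if "j \<in> J" for j
      using res_sub_sub[OF P insert.prems(1) w chC chU sub] that by simp
    have m: "res X ?S' S id w \<in> sect X ?S'"
      using presheaf_res_in[OF P chC insert.prems(1) _ w] by simp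
    show ?thesis
    proof
      assume "\<forall>j\<in>J. res X (subtopology S (U j)) S id w = z j"
      then show "res X ?S' S id w = b" using bu[OF m] e by simp
    next
      assume h: "res X ?S' S id w = b"
      show "\<forall>j\<in>J. res X (subtopology S (U j)) S id w = z j"
        using e b(2) unfolding h by force
    qed
  qed
  have "\<exists>!w. w \<in> sect X S \<and> res X (subtopology S (U k)) S id w = z k \<and> res X ?S' S id w = b"
    by (rule condensed_split[OF assms(1) insert.prems(1) _ _ insert.prems(5) b(1)]) (use insert.prems(2) in blast)+
  moreover have "(w \<in> sect X S \<and> (\<forall>j\<in>insert k J. res X (subtopology S (U j)) S id w = z j)) \<longleftrightarrow>
      (w \<in> sect X S \<and> res X (subtopology S (U k)) S id w = z k \<and> res X ?S' S id w = b)" for w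
    using key[of w] by blast
  ultimately show ?case by (simp only:)
qed

lemma clopen_fibre_set:
  assumes "continuous_map S (discrete_topology I) f"
  shows "openin S {s \<in> topspace S. f s = i}" "closedin S {s \<in> topspace S. f s = i}"
proof -
  have "{s \<in> topspace S. f s = i} = {s \<in> topspace S. f s \<in> {i} \<inter> I}"
    using assms continuous_map_image_subset_topspace[of S "discrete_topology I" f] by auto
  then show "openin S {s \<in> topspace S. f s = i}" "closedin S {s \<in> topspace S. f s = i}"
    using openin_continuous_map_preimage[OF assms, of "{i} \<inter> I"]
      closedin_continuous_map_preimage[OF assms, of "{i} \<inter> I"] by auto
qed

lemma ched_fibre:
  assumes "ched S" "continuous_map S (discrete_topology I) f"
  shows "ched (fibre S f i)"
  unfolding fibre_def by (rule ched_subtopology[OF assms(1)]) (rule clopen_fibre_set[OF assms(2)])+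

lemma topspace_fibre [simp]: "topspace (fibre S f i) = {s \<in> topspace S. f s = i}"
  by (auto simp: fibre_def)

lemma condensed_glue:
  assumes "condensed_set X" "ched S" "continuous_map S (discrete_topology I) f"
    and "\<And>i. i \<in> I \<Longrightarrow> z i \<in> sect X (fibre S f i)"
  shows "\<exists>!w. w \<in> sect X S \<and> (\<forall>i\<in>I. res X (fibre S f i) S id w = z i)"
proof -
  note P = condensed_presheaf[OF assms(1)]
  let ?J = "f ` topspace S"
  have JI: "?J \<subseteq> I" using continuous_map_image_subset_topspace[OF assms(3)] by simp
  have "compactin (discrete_topology I) ?J"
    using image_compactin[OF _ assms(3), of "topspace S"] assms(2) by (simp add: ched_def compact_space_def)
  then have fin: "finite ?J" by (simp add: compactin_discrete_topology)
  have ex: "\<exists>!w. w \<in> sect X S \<and> (\<forall>j\<in>?J. res X (subtopology S {s \<in> topspace S. f s = j}) S id w = z j)"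
    by (rule condensed_glue_finite[OF assms(1) fin assms(2)])
      (use clopen_fibre_set[OF assms(3)] assms(4) JI in \<open>auto simp: fibre_def disjoint_family_on_def\<close>)
  have "res X (fibre S f i) S id w = z i" if "i \<in> I" "i \<notin> ?J" "w \<in> sect X S" for i w
  proof -
    have "topspace (fibre S f i) = {}" using that by auto
    then have "\<exists>!x. x \<in> sect X (fibre S f i)" using condensed_trivial[OF assms(1)] by blast
    moreover have "res X (fibre S f i) S id w \<in> sect X (fibre S f i)"
      using presheaf_res_in[OF P ched_fibre[OF assms(2,3)] assms(2) _ that(3)] by (simp add: fibre_def)
    ultimately show ?thesis using assms(4)[OF that(1)] by blast
  qed
  then have "(w \<in> sect X S \<and> (\<forall>i\<in>I. res X (fibre S f i) S id w = z i)) \<longleftrightarrow>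
       (w \<in> sect X S \<and> (\<forall>j\<in>?J. res X (subtopology S {s \<in> topspace S. f s = j}) S id w = z j))" for w
    using JI unfolding fibre_def by blast
  then show ?thesis using ex by (simp only:)
qed

lemma fibre_cong: "(\<And>s. s \<in> topspace S \<Longrightarrow> f s = g s) \<Longrightarrow> fibre S f i = fibre S g i"
  unfolding fibre_def by (rule arg_cong[where f = "subtopology S"]) auto

lemma fibre_const [simp]: "fibre S (\<lambda>_. i) i = S"
  by (simp add: fibre_def)

lemma fibre_empty: "(\<And>s. s \<in> topspace S \<Longrightarrow> f s \<noteq> i) \<Longrightarrow> fibre S f i = trivial_topology"
  using null_topspace_iff_trivial[of "fibre S f i"] by (simp del: null_topspace_iff_trivial)

lemma continuous_fibre_id [simp]: "continuous_map (fibre S f i) S id"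
  by (simp add: fibre_def)

lemma continuous_fibre_map:
  assumes "continuous_map R S k" "\<And>s. s \<in> topspace R \<Longrightarrow> g s = f (k s)"
  shows "continuous_map (fibre R g i) (fibre S f i) k"
  unfolding fibre_def
  by (rule continuous_map_into_subtopology[OF continuous_map_from_subtopology[OF assms(1)]])
    (use assms(2) continuous_map_image_subset_topspace[OF assms(1)] in auto)

lemma continuous_map_discrete_iff:
  "continuous_map S (discrete_topology I) f \<longleftrightarrow>
     f \<in> topspace S \<rightarrow> I \<and> (\<forall>i\<in>I. openin S {s \<in> topspace S. f s = i})" (is "_ \<longleftrightarrow> ?A \<and> ?B")
proof
  assume "?A \<and> ?B"
  moreover have "openin S {s \<in> topspace S. f s \<in> V}" if "?A" "?B" "V \<subseteq> I" for V
  proof -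
    have "{s \<in> topspace S. f s \<in> V} = (\<Union>i\<in>V. {s \<in> topspace S. f s = i})" by auto
    then show ?thesis using that by (auto intro!: openin_Union)
  qed
  ultimately show "continuous_map S (discrete_topology I) f"
    by (simp add: continuous_map_def)
next
  assume f: "continuous_map S (discrete_topology I) f"
  then show "?A \<and> ?B"
    using clopen_fibre_set[OF f] continuous_map_image_subset_topspace[OF f] by auto
qed

lemma sect_coprod:
  "(f, y) \<in> sect (coprod_cset I Y) S \<longleftrightarrow>
     continuous_map S (discrete_topology I) f \<and> f \<in> extensional (topspace S) \<and>
     y \<in> (\<Pi>\<^sub>E i\<in>I. sect (Y i) (fibre S f i))"
  by (simp add: coprod_cset_def underline_def)

lemma res_coprod:
  "res (coprod_cset I Y) R S k (f, y) =
     (restrict (f \<circ> k) (topspace R), \<lambda>i\<in>I. res (Y i) (fibre R (f \<circ> k) i) (fibre S f i) k (y i))"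
  by (simp add: coprod_cset_def underline_def)

lemma bij_betwI_ex1:
  assumes "F \<in> A \<rightarrow> B" "\<And>b. b \<in> B \<Longrightarrow> \<exists>!x. x \<in> A \<and> F x = b"
  shows "bij_betw F A B"
proof -
  have "inj_on F A"
  proof (rule inj_onI)
    fix x y assume "x \<in> A" "y \<in> A" "F x = F y"
    with assms(2)[of "F x"] assms(1) show "x = y" by (auto simp: Pi_iff)
  qed
  moreover have "B \<subseteq> F ` A"
  proof
    fix b assume "b \<in> B"
    then obtain x where "x \<in> A" "F x = b" using assms(2)[of b] by blast
    then show "b \<in> F ` A" by blast
  qed
  ultimately show ?thesis using assms(1) by (auto simp: bij_betw_def)
qed

lemma presheaf_coprod:
  fixes Y :: "'i \<Rightarrow> ('p, 'x) cset"
  assumes Y: "\<And>i. i \<in> I \<Longrightarrow> presheaf (Y i)"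
  shows "presheaf (coprod_cset I Y)"
  unfolding presheaf_def
proof (intro conjI allI impI ballI; (elim conjE)?)
  fix S T :: "'p topology" and k
  assume S: "ched S" and T: "ched T" and k: "continuous_map S T k"
  show "res (coprod_cset I Y) S T k \<in> sect (coprod_cset I Y) T \<rightarrow> sect (coprod_cset I Y) S"
  proof (rule funcsetI, clarify)
    fix f y assume "(f, y) \<in> sect (coprod_cset I Y) T"
    then have f: "continuous_map T (discrete_topology I) f"
      and y: "\<And>i. i \<in> I \<Longrightarrow> y i \<in> sect (Y i) (fibre T f i)" by (auto simp: sect_coprod)
    have fk: "continuous_map S (discrete_topology I) (f \<circ> k)"
      using k f by (rule continuous_map_compose)
    have eq: "fibre S (restrict (f \<circ> k) (topspace S)) i = fibre S (f \<circ> k) i" for i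
      by (rule fibre_cong) simp
    have "continuous_map S (discrete_topology I) (restrict (f \<circ> k) (topspace S))"
      by (rule continuous_map_eq[OF fk]) simp
    moreover have "res (Y i) (fibre S (f \<circ> k) i) (fibre T f i) k (y i) \<in> sect (Y i) (fibre S (f \<circ> k) i)"
      if "i \<in> I" for i
      by (rule presheaf_res_in[OF Y[OF that] ched_fibre[OF S fk] ched_fibre[OF T f] _ y[OF that]])
        (rule continuous_fibre_map[OF k], simp)
    ultimately show "res (coprod_cset I Y) S T k (f, y) \<in> sect (coprod_cset I Y) S"
      by (auto simp: res_coprod sect_coprod eq)
  qed
next
  fix S T :: "'p topology" and k k' x
  assume S: "ched S" and T: "ched T" and k: "continuous_map S T k" "continuous_map S T k'"
    and kk: "\<forall>s\<in>topspace S. k s = k' s" and x: "x \<in> sect (coprod_cset I Y) T"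
  obtain f y where xe: "x = (f, y)" by (cases x)
  have f: "continuous_map T (discrete_topology I) f"
    and y: "\<And>i. i \<in> I \<Longrightarrow> y i \<in> sect (Y i) (fibre T f i)" using x by (auto simp: sect_coprod xe)
  have fk: "continuous_map S (discrete_topology I) (f \<circ> k)"
    using k(1) f by (rule continuous_map_compose)
  have eq: "fibre S (f \<circ> k') i = fibre S (f \<circ> k) i" for i
    by (rule fibre_cong) (use kk in simp)
  have "res (Y i) (fibre S (f \<circ> k) i) (fibre T f i) k (y i) = res (Y i) (fibre S (f \<circ> k) i) (fibre T f i) k' (y i)"
    if "i \<in> I" for i
    by (rule presheaf_res_cong[OF Y[OF that] ched_fibre[OF S fk] ched_fibre[OF T f] _ y[OF that]])
      (use kk in \<open>auto intro!: continuous_fibre_map k\<close>)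
  then show "res (coprod_cset I Y) S T k x = res (coprod_cset I Y) S T k' x"
    using kk by (auto simp: res_coprod xe eq fun_eq_iff)
next
  fix S :: "'p topology" and x
  assume S: "ched S" and x: "x \<in> sect (coprod_cset I Y) S"
  obtain f y where xe: "x = (f, y)" by (cases x)
  have f: "continuous_map S (discrete_topology I) f" "f \<in> extensional (topspace S)"
    and y: "y \<in> (\<Pi>\<^sub>E i\<in>I. sect (Y i) (fibre S f i))" using x by (auto simp: sect_coprod xe)
  have "res (Y i) (fibre S f i) (fibre S f i) id (y i) = y i" if "i \<in> I" for i
    using presheaf_res_id[OF Y[OF that] ched_fibre[OF S f(1)]] y that by blast
  then have "(\<lambda>i\<in>I. res (Y i) (fibre S f i) (fibre S f i) id (y i)) = (\<lambda>i\<in>I. y i)"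
    by (auto simp: fun_eq_iff)
  also have "\<dots> = y" using y by simp
  finally show "res (coprod_cset I Y) S S id x = x"
    using f by (simp add: res_coprod xe extensional_restrict)
next
  fix R S T :: "'p topology" and k m x
  assume R: "ched R" and S: "ched S" and T: "ched T" and k: "continuous_map R S k"
    and m: "continuous_map S T m" and x: "x \<in> sect (coprod_cset I Y) T"
  obtain f y where xe: "x = (f, y)" by (cases x)
  have f: "continuous_map T (discrete_topology I) f"
    and y: "\<And>i. i \<in> I \<Longrightarrow> y i \<in> sect (Y i) (fibre T f i)" using x by (auto simp: sect_coprod xe)
  have fm: "continuous_map S (discrete_topology I) (f \<circ> m)"
    using m f by (rule continuous_map_compose)
  have fmk: "continuous_map R (discrete_topology I) (f \<circ> (m \<circ> k))"
    using continuous_map_compose[OF k fm] by (simp add: comp_assoc)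
  have kt: "k s \<in> topspace S" if "s \<in> topspace R" for s
    using continuous_map_image_subset_topspace[OF k] that by auto
  have eq1: "fibre S (restrict (f \<circ> m) (topspace S)) i = fibre S (f \<circ> m) i" for i
    by (rule fibre_cong) simp
  have eq2: "fibre R (restrict (f \<circ> m) (topspace S) \<circ> k) i = fibre R (f \<circ> (m \<circ> k)) i" for i
    by (rule fibre_cong) (simp add: kt)
  have "res (Y i) (fibre R (f \<circ> (m \<circ> k)) i) (fibre S (f \<circ> m) i) k
           (res (Y i) (fibre S (f \<circ> m) i) (fibre T f i) m (y i))
        = res (Y i) (fibre R (f \<circ> (m \<circ> k)) i) (fibre T f i) (m \<circ> k) (y i)" if "i \<in> I" for i
    by (rule presheaf_res_comp[OF Y[OF that] ched_fibre[OF S fm] ched_fibre[OF T f] _ y[OF that] ched_fibre[OF R fmk]])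
      (auto intro!: continuous_fibre_map k m)
  then show "res (coprod_cset I Y) R T (m \<circ> k) x
      = res (coprod_cset I Y) R S k (res (coprod_cset I Y) S T m x)"
    by (auto simp: res_coprod xe eq1 eq2 fun_eq_iff kt)
qed

lemma condensed_split':
  assumes X: "condensed_set X" and F: "ched F" and U: "openin F U" "closedin F U"
    and A: "A = subtopology F U" and B: "B = subtopology F (topspace F - U)"
    and a: "a \<in> sect X A" and b: "b \<in> sect X B"
  shows "\<exists>!x. x \<in> sect X F \<and> res X A F id x = a \<and> res X B F id x = b"
  using condensed_split[OF X F U] a b unfolding A B by blast

lemma condensed_coprod:
  fixes Y :: "'i \<Rightarrow> ('p, 'x) cset"
  assumes Y: "\<And>i. i \<in> I \<Longrightarrow> condensed_set (Y i)"
  shows "condensed_set (coprod_cset I Y)"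
  unfolding condensed_set_def
proof (intro conjI allI impI; (elim conjE)?)
  show P: "presheaf (coprod_cset I Y)"
    by (rule presheaf_coprod) (rule condensed_presheaf[OF Y])
  have triv: "fibre trivial_topology f i = trivial_topology" for f :: "'p \<Rightarrow> 'i" and i
    by (rule fibre_empty) simp
  have ex1: "\<exists>!x. x \<in> sect (Y i) trivial_topology" if "i \<in> I" for i
    using condensed_trivial[OF Y[OF that], of trivial_topology] by simp
  define e where "e = (\<lambda>i\<in>I. THE x. x \<in> sect (Y i) trivial_topology)"
  have e: "e \<in> (\<Pi>\<^sub>E i\<in>I. sect (Y i) trivial_topology)"
    using theI'[OF ex1] by (simp add: e_def)
  have eu: "y = e" if "y \<in> (\<Pi>\<^sub>E i\<in>I. sect (Y i) trivial_topology)" for y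
    by (rule PiE_ext[OF that e]) (use that e ex1 in \<open>blast dest: PiE_mem\<close>)
  show "\<exists>!x. x \<in> sect (coprod_cset I Y) trivial_topology"
  proof (rule ex1I[of _ "(\<lambda>_. undefined, e)"])
    show "(\<lambda>_. undefined, e) \<in> sect (coprod_cset I Y) trivial_topology"
      using e by (simp add: sect_coprod triv)
    fix x assume x: "x \<in> sect (coprod_cset I Y) trivial_topology"
    obtain f y where xe: "x = (f, y)" by (cases x)
    show "x = (\<lambda>_. undefined, e)"
      using x eu[of y] by (simp add: sect_coprod triv xe)
  qed
  fix S :: "'p topology" and U
  assume S: "ched S" and U: "openin S U" "closedin S U"
  let ?C = "coprod_cset I Y" and ?D = "discrete_topology I"
  let ?V = "topspace S - U"
  let ?A = "subtopology S U" and ?B = "subtopology S ?V"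
  have V: "openin S ?V" "closedin S ?V" using U by auto
  have A: "ched ?A" and B: "ched ?B" using ched_subtopology S U V by blast+
  have US: "U \<subseteq> topspace S" using U openin_subset by blast
  then have tA: "topspace ?A = U" and tB: "topspace ?B = ?V" by auto
  show "bij_betw (\<lambda>x. (res ?C ?A S id x, res ?C ?B S id x)) (sect ?C S) (sect ?C ?A \<times> sect ?C ?B)"
  proof (rule bij_betwI_ex1)
    show "(\<lambda>x. (res ?C ?A S id x, res ?C ?B S id x)) \<in> sect ?C S \<rightarrow> sect ?C ?A \<times> sect ?C ?B"
      using presheaf_res_in[OF P A S] presheaf_res_in[OF P B S] by auto
    fix p assume "p \<in> sect ?C ?A \<times> sect ?C ?B"
    then obtain f1 y1 f2 y2 where p: "p = ((f1, y1), (f2, y2))"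
      and p1: "(f1, y1) \<in> sect ?C ?A" and p2: "(f2, y2) \<in> sect ?C ?B" by auto
    have f1: "continuous_map ?A ?D f1" "f1 \<in> extensional U"
      and y1: "y1 \<in> (\<Pi>\<^sub>E i\<in>I. sect (Y i) (fibre ?A f1 i))"
      using p1 unfolding sect_coprod tA by blast+
    have f2: "continuous_map ?B ?D f2" "f2 \<in> extensional ?V"
      and y2: "y2 \<in> (\<Pi>\<^sub>E i\<in>I. sect (Y i) (fibre ?B f2 i))"
      using p2 unfolding sect_coprod tB by blast+
    define f where "f = (\<lambda>s\<in>topspace S. if s \<in> U then f1 s else f2 s)"
    have ff1: "f s = f1 s" if "s \<in> U" for s using that US by (auto simp: f_def)
    have ff2: "f s = f2 s" if "s \<in> ?V" for s using that by (auto simp: f_def)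
    have f: "continuous_map S ?D f"
      unfolding continuous_map_discrete_iff
    proof (intro conjI ballI)
      show "f \<in> topspace S \<rightarrow> I"
        using f1(1) f2(1) by (auto simp: continuous_map_discrete_iff f_def Pi_iff)
      fix i assume "i \<in> I"
      have "openin ?A {s \<in> topspace ?A. f1 s = i}" "openin ?B {s \<in> topspace ?B. f2 s = i}"
        using clopen_fibre_set[OF f1(1)] clopen_fibre_set[OF f2(1)] by blast+
      then have "openin S {s \<in> U. f1 s = i}" "openin S {s \<in> ?V. f2 s = i}"
        unfolding tA tB using openin_open_subtopology U(1) V(1) by blast+
      moreover have "{s \<in> topspace S. f s = i} = {s \<in> U. f1 s = i} \<union> {s \<in> ?V. f2 s = i}"
        using US by (auto simp: f_def)
      ultimately show "openin S {s \<in> topspace S. f s = i}" by (simp add: openin_Un)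
    qed
    have FA: "fibre ?A f1 i = subtopology (fibre S f i) (U \<inter> topspace (fibre S f i))" for i
      unfolding fibre_def subtopology_subtopology using US ff1
      by (auto intro!: arg_cong[where f = "subtopology S"])
    have FB: "fibre ?B f2 i = subtopology (fibre S f i)
          (topspace (fibre S f i) - U \<inter> topspace (fibre S f i))" for i
      unfolding fibre_def subtopology_subtopology using US ff2
      by (auto intro!: arg_cong[where f = "subtopology S"])
    have clF: "openin (fibre S f i) (U \<inter> topspace (fibre S f i))"
       "closedin (fibre S f i) (U \<inter> topspace (fibre S f i))" for i
      using U unfolding fibre_def openin_subtopology closedin_subtopology by fastforce+
    have ex: "\<exists>!x. x \<in> sect (Y i) (fibre S f i) \<and> res (Y i) (fibre ?A f1 i) (fibre S f i) id x = y1 i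
        \<and> res (Y i) (fibre ?B f2 i) (fibre S f i) id x = y2 i" if "i \<in> I" for i
      by (rule condensed_split'[OF Y[OF that] ched_fibre[OF S f] clF FA FB])
        (use y1 y2 that in auto)
    define y where "y = (\<lambda>i\<in>I. THE x. x \<in> sect (Y i) (fibre S f i)
        \<and> res (Y i) (fibre ?A f1 i) (fibre S f i) id x = y1 i
        \<and> res (Y i) (fibre ?B f2 i) (fibre S f i) id x = y2 i)"
    have y: "y i \<in> sect (Y i) (fibre S f i) \<and> res (Y i) (fibre ?A f1 i) (fibre S f i) id (y i) = y1 i
        \<and> res (Y i) (fibre ?B f2 i) (fibre S f i) id (y i) = y2 i" if "i \<in> I" for i
      using theI'[OF ex[OF that]] that by (simp add: y_def)
    have eqA: "fibre ?A f i = fibre ?A f1 i" and eqB: "fibre ?B f i = fibre ?B f2 i" for i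
      by (rule fibre_cong, use ff1 ff2 tA tB in force)+
    show "\<exists>!x. x \<in> sect ?C S \<and> (res ?C ?A S id x, res ?C ?B S id x) = p"
    proof (rule ex1I[of _ "(f, y)"])
      have "(f, y) \<in> sect ?C S"
        using f y by (auto simp: sect_coprod f_def y_def)
      moreover have "restrict f (topspace ?A) = f1"
        by (rule extensionalityI[of _ U]) (use f1(2) ff1 tA in auto)
      moreover have "restrict f (topspace ?B) = f2"
        by (rule extensionalityI[of _ ?V]) (use f2(2) ff2 tB in auto)
      moreover have "(\<lambda>i\<in>I. res (Y i) (fibre ?A f1 i) (fibre S f i) id (y i)) = y1"
        by (rule extensionalityI[of _ I]) (use y y1 in \<open>auto simp: PiE_def\<close>)
      moreover have "(\<lambda>i\<in>I. res (Y i) (fibre ?B f2 i) (fibre S f i) id (y i)) = y2"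
        by (rule extensionalityI[of _ I]) (use y y2 in \<open>auto simp: PiE_def\<close>)
      ultimately show "(f, y) \<in> sect ?C S \<and> (res ?C ?A S id (f, y), res ?C ?B S id (f, y)) = p"
        by (simp only: res_coprod comp_id eqA eqB p)
    next
      fix x assume x: "x \<in> sect ?C S \<and> (res ?C ?A S id x, res ?C ?B S id x) = p"
      obtain f' y' where xe: "x = (f', y')" by (cases x)
      have f': "f' \<in> extensional (topspace S)" and y': "y' \<in> (\<Pi>\<^sub>E i\<in>I. sect (Y i) (fibre S f' i))"
        using x by (simp_all add: xe sect_coprod)
      have r: "restrict f' (topspace ?A) = f1" "restrict f' (topspace ?B) = f2"
        "(\<lambda>i\<in>I. res (Y i) (fibre ?A f' i) (fibre S f' i) id (y' i)) = y1"
        "(\<lambda>i\<in>I. res (Y i) (fibre ?B f' i) (fibre S f' i) id (y' i)) = y2"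
        using x by (simp_all only: xe res_coprod comp_id p prod.inject)
      have ff: "f' = f"
      proof (rule extensionalityI[OF f'])
        show "f \<in> extensional (topspace S)" by (simp add: f_def)
        fix s assume s: "s \<in> topspace S"
        show "f' s = f s"
        proof (cases "s \<in> U")
          case True
          then show ?thesis using fun_cong[OF r(1), of s] ff1[OF True] s by simp
        next
          case False
          then show ?thesis using fun_cong[OF r(2), of s] ff2[of s] s by simp
        qed
      qed
      have "y' i = y i" if "i \<in> I" for i
      proof -
        have "res (Y i) (fibre ?A f1 i) (fibre S f i) id (y' i) = y1 i"
          "res (Y i) (fibre ?B f2 i) (fibre S f i) id (y' i) = y2 i"
          using fun_cong[OF r(3), of i] fun_cong[OF r(4), of i] that by (simp_all add: ff eqA eqB)
        moreover have "y' i \<in> sect (Y i) (fibre S f i)" using y' that ff by auto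
        ultimately show ?thesis using ex[OF that] y[OF that] by blast
      qed
      then have "y' = y"
        by (intro extensionalityI[of _ I]) (use y' in \<open>auto simp: y_def PiE_def\<close>)
      then show "x = (f, y)" using ff xe by simp
    qed
  qed
qed

lemma coprod_inj_in:
  assumes Y: "\<And>i. i \<in> I \<Longrightarrow> condensed_set (Y i)" and j: "j \<in> I" and S: "ched S" and x: "x \<in> sect (Y j) S"
  shows "coprod_inj I Y j S x \<in> sect (coprod_cset I Y) S"
    and "snd (coprod_inj I Y j S x) j = x"
proof -
  have x': "res (Y j) S S id x = x"
    by (rule presheaf_res_id[OF condensed_presheaf[OF Y[OF j]] S x])
  have eq: "fibre S (\<lambda>s\<in>topspace S. j) i = (if i = j then S else trivial_topology)" for i
  proof -
    have "fibre S (\<lambda>s\<in>topspace S. j) i = fibre S (\<lambda>s. j) i" by (rule fibre_cong) simp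
    then show ?thesis by (auto intro: fibre_empty)
  qed
  have "(THE z. z \<in> sect (Y i) trivial_topology) \<in> sect (Y i) trivial_topology" if "i \<in> I" for i
    by (rule theI') (rule condensed_trivial[OF Y[OF that]], simp)
  moreover have "continuous_map S (discrete_topology I) (\<lambda>s\<in>topspace S. j)"
    by (rule continuous_map_eq[of _ _ "\<lambda>_. j"]) (use j in auto)
  ultimately show "coprod_inj I Y j S x \<in> sect (coprod_cset I Y) S"
    using x by (auto simp: coprod_inj_def sect_coprod eq x')
  show "snd (coprod_inj I Y j S x) j = x"
    using j x' by (simp add: coprod_inj_def)
qed

text \<open>If \<open>j\<close> is the only index with a nonempty fibre, a section comes from \<open>Y j\<close>.\<close>

lemma coprod_inj_unique:
  assumes Y: "\<And>i. i \<in> I \<Longrightarrow> condensed_set (Y i)" and j: "j \<in> I" and S: "ched S"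
    and m: "(f, y) \<in> sect (coprod_cset I Y) S" and f: "\<And>s. s \<in> topspace S \<Longrightarrow> f s = j"
  shows "y j \<in> sect (Y j) S" "coprod_inj I Y j S (y j) = (f, y)"
proof -
  have fj: "fibre S f j = S"
    using fibre_cong[of S f "\<lambda>_. j" j] f by simp
  have y: "y \<in> (\<Pi>\<^sub>E i\<in>I. sect (Y i) (fibre S f i))" and fe: "f \<in> extensional (topspace S)"
    using m by (simp_all add: sect_coprod)
  show yj: "y j \<in> sect (Y j) S" using y j fj by (metis PiE_mem)
  have z: "snd (coprod_inj I Y j S (y j)) i = y i" if "i \<in> I" for i
  proof (cases "i = j")
    case True
    then show ?thesis using coprod_inj_in(2)[of I Y, OF Y j S yj] by simp
  next
    case False
    have "fibre S f i = trivial_topology" by (rule fibre_empty) (use f False in auto)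
    then have "y i \<in> sect (Y i) trivial_topology" using y that by (metis PiE_mem)
    then have "(THE z. z \<in> sect (Y i) trivial_topology) = y i"
      using condensed_trivial[OF Y[OF that], of trivial_topology] by (intro the1_equality) auto
    then show ?thesis using False that by (simp add: coprod_inj_def)
  qed
  have "snd (coprod_inj I Y j S (y j)) = y"
    by (rule extensionalityI[of _ I]) (use y z in \<open>auto simp: coprod_inj_def PiE_def\<close>)
  moreover have "fst (coprod_inj I Y j S (y j)) = f"
    by (rule extensionalityI[of _ "topspace S"]) (use f fe in \<open>auto simp: coprod_inj_def\<close>)
  ultimately show "coprod_inj I Y j S (y j) = (f, y)" by (metis prod.collapse)
qed


lemma coprod_inj_hom:
  fixes Y :: "'i \<Rightarrow> ('p, 'x) cset"
  assumes Y: "\<And>i. i \<in> I \<Longrightarrow> condensed_set (Y i)" and j: "j \<in> I"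
  shows "cset_hom (Y j) (coprod_cset I Y) (coprod_inj I Y j)"
  unfolding cset_hom_def
proof (intro conjI allI impI ballI; (elim conjE)?)
  show "coprod_inj I Y j S \<in> sect (Y j) S \<rightarrow> sect (coprod_cset I Y) S" if "ched S" for S
    using coprod_inj_in(1)[of I Y, OF Y j that] by blast
  fix S T :: "'p topology" and k x
  assume S: "ched S" and T: "ched T" and k: "continuous_map S T k" and x: "x \<in> sect (Y j) T"
  let ?C = "coprod_cset I Y"
  have P: "presheaf ?C" by (rule presheaf_coprod) (rule condensed_presheaf[OF Y])
  obtain f y where e: "coprod_inj I Y j T x = (f, y)" by fastforce
  have yj: "y j = x" using coprod_inj_in(2)[of I Y, OF Y j T x] e by simp
  have f: "f t = j" if "t \<in> topspace T" for t
    using e that by (auto simp: coprod_inj_def)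
  have kt: "k s \<in> topspace T" if "s \<in> topspace S" for s
    using continuous_map_image_subset_topspace[OF k] that by auto
  have "(f, y) \<in> sect ?C T" using coprod_inj_in(1)[of I Y, OF Y j T x] e by simp
  then have r: "res ?C S T k (f, y) \<in> sect ?C S" by (rule presheaf_res_in[OF P S T k])
  have fib: "fibre S (f \<circ> k) j = S" "fibre T f j = T"
    using fibre_cong[of S "f \<circ> k" "\<lambda>_. j" j] fibre_cong[of T f "\<lambda>_. j" j] f kt by simp_all
  have r2: "(restrict (f \<circ> k) (topspace S), \<lambda>i\<in>I. res (Y i) (fibre S (f \<circ> k) i) (fibre T f i) k (y i)) \<in> sect ?C S"
    using r unfolding res_coprod .
  have "coprod_inj I Y j S (res (Y j) S T k x) = res ?C S T k (f, y)"
    using coprod_inj_unique(2)[of I Y, OF Y j S r2] j f kt fib yj by (simp add: res_coprod)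
  then show "coprod_inj I Y j S (res (Y j) S T k x) = res ?C S T k (coprod_inj I Y j T x)"
    by (simp add: e)
qed

lemma coprod_restrict_fibre:
  fixes Y :: "'i \<Rightarrow> ('p, 'x) cset"
  assumes Y: "\<And>i. i \<in> I \<Longrightarrow> condensed_set (Y i)" and j: "j \<in> I" and S: "ched S"
    and m: "(f, y) \<in> sect (coprod_cset I Y) S"
  shows "y j \<in> sect (Y j) (fibre S f j)"
    and "res (coprod_cset I Y) (fibre S f j) S id (f, y) = coprod_inj I Y j (fibre S f j) (y j)"
proof -
  let ?C = "coprod_cset I Y" and ?F = "fibre S f j"
  have P: "presheaf ?C" by (rule presheaf_coprod) (rule condensed_presheaf[OF Y])
  have f: "continuous_map S (discrete_topology I) f" and y: "y j \<in> sect (Y j) ?F"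
    using m j by (auto simp: sect_coprod)
  show "y j \<in> sect (Y j) ?F" by (rule y)
  have F: "ched ?F" by (rule ched_fibre[OF S f])
  have r: "res ?C ?F S id (f, y) \<in> sect ?C ?F"
    by (rule presheaf_res_in[OF P F S _ m]) simp
  have FF: "fibre ?F f j = ?F"
    using fibre_cong[of ?F f "\<lambda>_. j" j] by simp
  have r2: "(restrict f (topspace ?F), \<lambda>i\<in>I. res (Y i) (fibre ?F f i) (fibre S f i) id (y i)) \<in> sect ?C ?F"
    using r unfolding res_coprod comp_id .
  have "res (Y j) ?F ?F id (y j) = y j"
    by (rule presheaf_res_id[OF condensed_presheaf[OF Y[OF j]] F y])
  then show "res ?C ?F S id (f, y) = coprod_inj I Y j ?F (y j)"
    using coprod_inj_unique(2)[of I Y, OF Y j F r2] j FF unfolding res_coprod comp_id by simp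
qed

lemma cset_homD:
  assumes "cset_hom X Y \<phi>" "ched S"
  shows "x \<in> sect X S \<Longrightarrow> \<phi> S x \<in> sect Y S"
    and "ched T \<Longrightarrow> continuous_map S T f \<Longrightarrow> x \<in> sect X T \<Longrightarrow> \<phi> S (res X S T f x) = res Y S T f (\<phi> T x)"
proof -
  note a = assms(1)[unfolded cset_hom_def]
  show "\<phi> S x \<in> sect Y S" if "x \<in> sect X S"
    using conjunct1[OF a] assms(2) that by (simp add: Pi_iff)
  show "\<phi> S (res X S T f x) = res Y S T f (\<phi> T x)"
    if "ched T" "continuous_map S T f" "x \<in> sect X T"
    using conjunct2[OF a, rule_format, of S T f x] assms(2) that by simp
qed

theorem coprod_universal_unique:
  fixes Y :: "'i \<Rightarrow> ('p, 'x) cset" and Z :: "('p, 'z) cset"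
  assumes Y: "\<And>i. i \<in> I \<Longrightarrow> condensed_set (Y i)" and Z: "condensed_set Z"
    and g: "cset_hom (coprod_cset I Y) Z \<gamma>" and g': "cset_hom (coprod_cset I Y) Z \<gamma>'"
    and eq: "\<And>i S y. i \<in> I \<Longrightarrow> ched S \<Longrightarrow> y \<in> sect (Y i) S
          \<Longrightarrow> \<gamma> S (coprod_inj I Y i S y) = \<gamma>' S (coprod_inj I Y i S y)"
    and S: "ched S" and x: "x \<in> sect (coprod_cset I Y) S"
  shows "\<gamma> S x = \<gamma>' S x"
proof -
  obtain f y where xe: "x = (f, y)" by (cases x)
  have m: "(f, y) \<in> sect (coprod_cset I Y) S" using x xe by simp
  have f: "continuous_map S (discrete_topology I) f" using m by (simp add: sect_coprod)
  have "res Z (fibre S f i) S id (\<gamma> S x) = res Z (fibre S f i) S id (\<gamma>' S x)" if i: "i \<in> I" for i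
  proof -
    note F = ched_fibre[OF S f, of i]
    note r = coprod_restrict_fibre[of I Y, OF Y i S m]
    have "res Z (fibre S f i) S id (\<gamma> S x) = \<gamma> (fibre S f i) (coprod_inj I Y i (fibre S f i) (y i))"
      using cset_homD(2)[OF g F S _ x, of id] r(2) by (simp add: xe)
    moreover have "res Z (fibre S f i) S id (\<gamma>' S x) = \<gamma>' (fibre S f i) (coprod_inj I Y i (fibre S f i) (y i))"
      using cset_homD(2)[OF g' F S _ x, of id] r(2) by (simp add: xe)
    ultimately show ?thesis using eq[OF i F r(1)] by simp
  qed
  moreover have "res Z (fibre S f i) S id (\<gamma>' S x) \<in> sect Z (fibre S f i)" for i
    by (rule presheaf_res_in[OF condensed_presheaf[OF Z] ched_fibre[OF S f] S _ cset_homD(1)[OF g' S x]]) simp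
  ultimately show ?thesis
    using condensed_glue[OF Z S f, of "\<lambda>i. res Z (fibre S f i) S id (\<gamma>' S x)"]
      cset_homD(1)[OF g S x] cset_homD(1)[OF g' S x] by blast
qed

theorem coprod_universal_ex:
  fixes Y :: "'i \<Rightarrow> ('p, 'x) cset" and Z :: "('p, 'z) cset"
  assumes Y: "\<And>i. i \<in> I \<Longrightarrow> condensed_set (Y i)" and Z: "condensed_set Z"
    and b: "\<And>i. i \<in> I \<Longrightarrow> cset_hom (Y i) Z (\<beta> i)"
  shows "\<exists>\<gamma>. cset_hom (coprod_cset I Y) Z \<gamma> \<and>
    (\<forall>i\<in>I. \<forall>S. ched S \<longrightarrow> (\<forall>y\<in>sect (Y i) S. \<gamma> S (coprod_inj I Y i S y) = \<beta> i S y))"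
proof -
  let ?C = "coprod_cset I Y"
  note PZ = condensed_presheaf[OF Z]
  define Q where "Q = (\<lambda>(S :: 'p topology) x w. w \<in> sect Z S \<and>
     (\<forall>i\<in>I. res Z (fibre S (fst x) i) S id w = \<beta> i (fibre S (fst x) i) (snd x i)))"
  have ex: "\<exists>!w. Q S x w" if S: "ched S" and x: "x \<in> sect ?C S" for S x
  proof -
    have m: "(fst x, snd x) \<in> sect ?C S" using x by simp
    have f: "continuous_map S (discrete_topology I) (fst x)" using m unfolding sect_coprod by blast
    show ?thesis unfolding Q_def
      by (rule condensed_glue[OF Z S f])
        (rule cset_homD(1)[OF b ched_fibre[OF S f] coprod_restrict_fibre(1)[of I Y, OF Y _ S m]])
  qed
  define \<gamma> where "\<gamma> = (\<lambda>S x. THE w. Q S x w)"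
  have gQ: "Q S x (\<gamma> S x)" if "ched S" "x \<in> sect ?C S" for S x
    unfolding \<gamma>_def by (rule theI'[OF ex[OF that]])
  have gu: "\<gamma> S x = w" if "ched S" "x \<in> sect ?C S" "Q S x w" for S x w
    using ex[OF that(1,2)] gQ[OF that(1,2)] that(3) by blast
  have PC: "presheaf ?C" by (rule presheaf_coprod) (rule condensed_presheaf[OF Y])
  have "cset_hom ?C Z \<gamma>"
    unfolding cset_hom_def
  proof (intro conjI allI impI ballI; (elim conjE)?)
    show "\<gamma> S \<in> sect ?C S \<rightarrow> sect Z S" if "ched S" for S
      using gQ[OF that] by (auto simp: Q_def)
    fix S T :: "'p topology" and k x
    assume S: "ched S" and T: "ched T" and k: "continuous_map S T k" and x: "x \<in> sect ?C T"
    obtain f y where xe: "x = (f, y)" by (cases x)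
    have m: "(f, y) \<in> sect ?C T" using x xe by simp
    have f: "continuous_map T (discrete_topology I) f" using m by (simp add: sect_coprod)
    have fk: "continuous_map S (discrete_topology I) (f \<circ> k)"
      using k f by (rule continuous_map_compose)
    have gT: "\<gamma> T x \<in> sect Z T" using gQ[OF T x] by (simp add: Q_def)
    have eq: "fibre S (restrict (f \<circ> k) (topspace S)) i = fibre S (f \<circ> k) i" for i
      by (rule fibre_cong) simp
    show "\<gamma> S (res ?C S T k x) = res Z S T k (\<gamma> T x)"
    proof (rule gu[OF S presheaf_res_in[OF PC S T k x]])
      have "res Z (fibre S (f \<circ> k) i) S id (res Z S T k (\<gamma> T x))
          = \<beta> i (fibre S (f \<circ> k) i) (res (Y i) (fibre S (f \<circ> k) i) (fibre T f i) k (y i))" if i: "i \<in> I" for i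
      proof -
        note FS = ched_fibre[OF S fk, of i] and FT = ched_fibre[OF T f, of i]
        have kf: "continuous_map (fibre S (f \<circ> k) i) (fibre T f i) k"
          by (rule continuous_fibre_map[OF k]) simp
        have "res Z (fibre S (f \<circ> k) i) S id (res Z S T k (\<gamma> T x)) = res Z (fibre S (f \<circ> k) i) T k (\<gamma> T x)"
          using presheaf_res_comp[OF PZ S T k gT FS, of id] by simp
        also have "\<dots> = res Z (fibre S (f \<circ> k) i) (fibre T f i) k (res Z (fibre T f i) T id (\<gamma> T x))"
          using presheaf_res_comp[OF PZ FT T _ gT FS kf, of id] by simp
        also have "res Z (fibre T f i) T id (\<gamma> T x) = \<beta> i (fibre T f i) (y i)"
          using gQ[OF T x] i by (simp add: Q_def xe)
        also have "res Z (fibre S (f \<circ> k) i) (fibre T f i) k \<dots>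
           = \<beta> i (fibre S (f \<circ> k) i) (res (Y i) (fibre S (f \<circ> k) i) (fibre T f i) k (y i))"
          using cset_homD(2)[OF b[OF i] FS FT kf coprod_restrict_fibre(1)[of I Y, OF Y i T m]] by simp
        finally show ?thesis .
      qed
      then show "Q S (res ?C S T k x) (res Z S T k (\<gamma> T x))"
        using presheaf_res_in[OF PZ S T k gT] by (simp add: Q_def xe res_coprod eq)
    qed
  qed
  moreover have "\<gamma> S (coprod_inj I Y i S y) = \<beta> i S y" if i: "i \<in> I" and S: "ched S" and y: "y \<in> sect (Y i) S" for i S y
  proof -
    let ?x = "coprod_inj I Y i S y"
    have x: "?x \<in> sect ?C S" by (rule coprod_inj_in(1)[of I Y, OF Y i S y])
    have q: "Q S ?x (\<gamma> S ?x)" by (rule gQ[OF S x])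
    have "fibre S (fst ?x) i = S"
      using fibre_cong[of S "fst ?x" "\<lambda>_. i" i] by (simp add: coprod_inj_def)
    moreover have "snd ?x i = y" by (rule coprod_inj_in(2)[of I Y, OF Y i S y])
    ultimately have "res Z S S id (\<gamma> S ?x) = \<beta> i S y" using q i by (auto simp: Q_def)
    moreover have "\<gamma> S ?x \<in> sect Z S" using q by (simp add: Q_def)
    ultimately show ?thesis using presheaf_res_id[OF PZ S] by simp
  qed
  ultimately show ?thesis by blast
qed

end

theory Submission
  imports Defs
begin

text \<open>
  Pulled back along a section \<open>x \<in> X(S)\<close>, the left orbits become pairwise disjoint open subsets of
  \<open>S\<close> that cover it: a point \<open>s\<close> lies in the one belonging to the class of \<open>x(s)\<close>. Hence they are
  clopen, and on the subset belonging to \<open>c = Gx\<^sub>0\<close> the section \<open>x\<close> is a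
  section of the orbit \<open>Gx\<^sub>0\<close>. In other words, the class of \<open>x(s)\<close> is a locally constant function
  of \<open>s\<close>, and over each fibre of this function the class of \<open>x\<close> itself is the constant one
  (\<open>open_orbits_locally_constant\<close>). This property survives the passage from
  \<open>G \<setminus> X\<close> to its quotient \<open>G \<setminus> X/H\<close> because the latter is a sheaf, so that a class over a
  fibre may be compared with a constant class piece by piece (\<open>locally_constant_coarser\<close>). Right
  orbits are treated in the same way.

  Both claims follow by gluing over the fibres of locally constant functions. A section of
  \<open>G \<setminus> X/H\<close> is constant on each fibre of the function that it induces on points, so it is determined
  by this function, and every locally constant function arises by gluing constants
  (\<open>discrete_quotient\<close>). A section \<open>x\<close> of \<open>X\<close> is the gluing of its restrictions to those fibres,
  each of which is a section of one double orbit; thus the map from the coproduct of the double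
  orbits to \<open>X\<close> given by the inclusions is bijective (\<open>orbit_decomposition\<close>). It is equivariant, since
  the group actions on the coproduct are defined fibre by fibre, and its inverse is the required
  isomorphism.

  The argument about quotients uses only that orbits are the classes of an equivalence relation on
  the sections of \<open>X\<close> that is compatible with restriction and, for double orbits, can be checked
  on the pieces of a clopen partition. The two locales below isolate these properties, so
  that left, right and double orbits are handled together.
\<close>

section \<open>Maps to and from the point\<close>

lemma ched_pt: "ched (pt :: 'p topology)"
  using closure_of_subset_topspace[of "pt :: 'p topology"]
  by (simp add: ched_def pt_def compact_space_discrete_topology)

lemma topspace_pt: "topspace pt = {undefined}"
  by (simp add: pt_def)

lemma continuous_to_pt: "continuous_map S pt (\<lambda>_. undefined)"
  by (simp add: pt_def)

lemma continuous_from_pt: "s \<in> topspace S \<Longrightarrow> continuous_map pt S (\<lambda>_. s)"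
  by simp

lemma ched_trivial: "ched (trivial_topology :: 'p topology)"
  by (auto simp: ched_def compact_space_def)

lemma res_pt_pt:
  assumes "presheaf X" "x \<in> sect X pt"
  shows "res X pt pt (\<lambda>_. undefined) x = x"
proof -
  have "res X pt pt (\<lambda>_. undefined) x = res X pt pt id x"
    by (rule presheaf_res_cong[OF assms(1) ched_pt ched_pt continuous_to_pt assms(2)])
      (simp_all add: topspace_pt)
  then show ?thesis using presheaf_res_id[OF assms(1) ched_pt assms(2)] by simp
qed

section \<open>Quotients by congruences\<close>

text \<open>
  An equivalence relation on the presheaf \<open>X\<close>, given by its class maps: \<open>q S x\<close> is the class of
  \<open>x \<in> X(S)\<close>.
\<close>

locale congruence =
  fixes X :: "('p, 'x) cset" and q :: "'p topology \<Rightarrow> 'x \<Rightarrow> 'x set"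
  assumes presheaf: "presheaf X"
    and q_refl: "\<lbrakk>ched S; x \<in> sect X S\<rbrakk> \<Longrightarrow> x \<in> q S x"
    and q_sect: "\<lbrakk>ched S; x \<in> sect X S; y \<in> q S x\<rbrakk> \<Longrightarrow> y \<in> sect X S"
    and q_eq: "\<lbrakk>ched S; x \<in> sect X S; y \<in> q S x\<rbrakk> \<Longrightarrow> q S y = q S x"
    and q_res: "\<lbrakk>ched S; ched T; continuous_map S T f; x \<in> sect X T; y \<in> q T x\<rbrakk>
      \<Longrightarrow> res X S T f y \<in> q S (res X S T f x)"
begin

abbreviation Q :: "('p, 'x set) cset" where "Q \<equiv> quotient_cset X q"

lemma sect_Q: "sect Q S = q S ` sect X S"
  by (simp add: quotient_cset_def)

lemma res_Q:
  assumes "ched S" "ched T" "continuous_map S T f" "x \<in> sect X T"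
  shows "res Q S T f (q T x) = q S (res X S T f x)"
proof -
  have "q S (res X S T f y) = q S (res X S T f x)" if "y \<in> q T x" for y
    using q_eq[OF assms(1) presheaf_res_in[OF presheaf assms] q_res[OF assms that]] .
  then have "(\<Union>y\<in>q T x. q S (res X S T f y)) = (\<Union>y\<in>q T x. q S (res X S T f x))"
    by (intro SUP_cong refl)
  also have "\<dots> = q S (res X S T f x)" using q_refl[OF assms(2,4)] by blast
  finally show ?thesis by (simp add: quotient_cset_def)
qed

lemma presheaf_Q: "presheaf Q"
  unfolding presheaf_def
proof (intro conjI allI impI ballI; (elim conjE)?)
  show "res Q S T f \<in> sect Q T \<rightarrow> sect Q S"
    if "ched S" "ched T" "continuous_map S T f" for S T f
    using res_Q[OF that] presheaf_res_in[OF presheaf that] by (auto simp: sect_Q)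
  show "res Q S T f c = res Q S T g c"
    if a: "ched S" "ched T" "continuous_map S T f" and g: "continuous_map S T g"
      "\<forall>s\<in>topspace S. f s = g s" and c: "c \<in> sect Q T" for S T f g c
    using c res_Q[OF a] res_Q[OF a(1,2) g(1)] presheaf_res_cong[OF presheaf a _ g(1)] g(2)
    by (auto simp: sect_Q)
  show "res Q S S id c = c" if "ched S" "c \<in> sect Q S" for S c
    using that res_Q[OF that(1,1), of id] presheaf_res_id[OF presheaf that(1)]
    by (auto simp: sect_Q)
  show "res Q R T (g \<circ> f) c = res Q R S f (res Q S T g c)"
    if R: "ched R" and S: "ched S" and T: "ched T" and f: "continuous_map R S f"
      and g: "continuous_map S T g" and c: "c \<in> sect Q T" for R S T f g c
  proof -
    obtain x where x: "x \<in> sect X T" "c = q T x" using c by (auto simp: sect_Q)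
    show ?thesis
      using res_Q[OF S T g x(1)] res_Q[OF R T continuous_map_compose[OF f g] x(1)]
        res_Q[OF R S f presheaf_res_in[OF presheaf S T g x(1)]]
        presheaf_res_comp[OF presheaf S T g x(1) R f] x(2) by simp
  qed
qed

lemma sect_orbit:
  "y \<in> sect (orbit_cset X q c) S \<longleftrightarrow>
     y \<in> sect X S \<and> q S y = res Q S pt (\<lambda>_. undefined) c"
  by (simp add: orbit_cset_def)

lemma res_orbit: "res (orbit_cset X q c) = res X"
  by (simp add: orbit_cset_def)

text \<open>
  The constant class with value \<open>c\<close> over \<open>S\<close> is the pullback of \<open>c \<in> (X/q)(*)\<close> along \<open>S \<rightarrow> *\<close>, so
  its restrictions are constant with the same value.
\<close>

lemma res_const:
  assumes "ched R" "ched S" "continuous_map R S f" "c \<in> sect Q pt"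
  shows "res Q R S f (res Q S pt (\<lambda>_. undefined) c) = res Q R pt (\<lambda>_. undefined) c"
  using presheaf_res_comp[OF presheaf_Q assms(2) ched_pt continuous_to_pt assms(4,1,3)]
  by (simp add: comp_def)

lemma orbit_res_in:
  assumes "ched R" "ched S" "continuous_map R S f" "c \<in> sect Q pt"
    "y \<in> sect (orbit_cset X q c) S"
  shows "res X R S f y \<in> sect (orbit_cset X q c) R"
  using assms res_Q[OF assms(1-3), of y] res_const[OF assms(1-4)]
    presheaf_res_in[OF presheaf assms(1-3), of y] by (simp add: sect_orbit)

lemma eval_points_Q:
  assumes "ched S" "x \<in> sect X S" "s \<in> topspace S"
  shows "eval_points Q S (q S x) s = q pt (res X pt S (\<lambda>_. s) x)"
  using assms res_Q[OF ched_pt assms(1) continuous_from_pt assms(2)] by (simp add: eval_points_def)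

text \<open>
  Evaluation at \<open>s\<close> factors through the fibre that contains \<open>s\<close>, on which \<open>w\<close> is constant.
\<close>

lemma eval_points_const:
  assumes S: "ched S" and w: "w \<in> sect Q S" and c: "c \<in> sect Q pt" and F: "ched (fibre S f c)"
    and s: "s \<in> topspace S" "f s = c"
    and e: "res Q (fibre S f c) S id w = res Q (fibre S f c) pt (\<lambda>_. undefined) c"
  shows "eval_points Q S w s = c"
proof -
  have i: "continuous_map pt (fibre S f c) (\<lambda>_. s)" using s by (intro continuous_from_pt) simp
  have "eval_points Q S w s = res Q pt (fibre S f c) (\<lambda>_. s) (res Q (fibre S f c) S id w)"
    using presheaf_res_comp[OF presheaf_Q F S _ w ched_pt i, of id] s
    by (simp add: eval_points_def comp_def)
  also have "\<dots> = c"
    unfolding e res_const[OF ched_pt F i c] by (rule res_pt_pt[OF presheaf_Q c])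
  finally show ?thesis .
qed

text \<open>
  The property of a congruence on which everything rests. Every section \<open>x\<close> over \<open>S\<close> splits \<open>S\<close> into
  the fibres of the map \<open>s \<mapsto> [x(s)]\<close>. The first clause makes the fibres clopen. The
  second is not a consequence of the first: it requires that the class of \<open>x\<close> over the whole fibre is
  constant, not just the classes of its points.
\<close>

definition locally_constant_classes :: bool where
  "locally_constant_classes \<longleftrightarrow> (\<forall>S x. ched S \<longrightarrow> x \<in> sect X S \<longrightarrow>
     continuous_map S (discrete_topology (sect Q pt)) (eval_points Q S (q S x)) \<and>
     (\<forall>c\<in>sect Q pt. res X (fibre S (eval_points Q S (q S x)) c) S id x
        \<in> sect (orbit_cset X q c) (fibre S (eval_points Q S (q S x)) c)))"

lemma locally_constant_classesD:
  assumes "locally_constant_classes" "ched S" "x \<in> sect X S"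
  shows "continuous_map S (discrete_topology (sect Q pt)) (eval_points Q S (q S x))"
    and "c \<in> sect Q pt \<Longrightarrow> res X (fibre S (eval_points Q S (q S x)) c) S id x
        \<in> sect (orbit_cset X q c) (fibre S (eval_points Q S (q S x)) c)"
  using assms unfolding locally_constant_classes_def by blast+

lemma yoneda:
  assumes S: "ched S" and x: "x \<in> sect X S"
  shows "cset_hom (underline S) X (\<lambda>R f. res X R S f x)"
  unfolding cset_hom_def
proof (intro conjI allI impI ballI; (elim conjE)?)
  show "(\<lambda>f. res X R S f x) \<in> sect (underline S) R \<rightarrow> sect X R" if "ched R" for R
    using presheaf_res_in[OF presheaf that S _ x] by (auto simp: underline_def)
  fix R T :: "'p topology" and k f
  assume R: "ched R" and T: "ched T" and k: "continuous_map R T k"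
    and "f \<in> sect (underline S) T"
  then have f: "continuous_map T S f" by (simp add: underline_def)
  note fk = continuous_map_compose[OF k f]
  have "res X R S (f \<circ> k) x = res X R S (restrict (f \<circ> k) (topspace R)) x"
    by (rule presheaf_res_cong[OF presheaf R S fk x])
      (auto intro: continuous_map_eq[OF fk])
  moreover have "res (underline S) R T k f = restrict (f \<circ> k) (topspace R)"
    by (simp add: underline_def)
  ultimately show "res X R S (res (underline S) R T k f) x = res X R T k (res X T S f x)"
    using presheaf_res_comp[OF presheaf T S f x R k] by (simp only:)
qed

text \<open>
  The open subset \<open>P\<close> representing the pullback of an orbit is determined by
  testing it on \<open>R = *\<close>: it is the fibre of \<open>s \<mapsto> [x(s)]\<close> over \<open>c\<close>. Testing it on \<open>R = P\<close> then
  shows that \<open>x\<close> is in the orbit over all of \<open>P\<close>.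
\<close>

lemma open_orbits_locally_constant:
  assumes o: "open_orbits X q"
  shows locally_constant_classes
  unfolding locally_constant_classes_def
proof (intro allI impI)
  fix S x assume S: "ched S" and x: "x \<in> sect X S"
  let ?f = "eval_points Q S (q S x)"
  have P: "\<exists>P. openin S P \<and> (\<forall>R. ched R \<longrightarrow> (\<forall>f. continuous_map R S f \<longrightarrow> f \<in> extensional (topspace R) \<longrightarrow>
      (res X R S f x \<in> sect (orbit_cset X q c) R \<longleftrightarrow> continuous_map R (subtopology S P) f)))"
    if c: "c \<in> sect Q pt" for c
  proof -
    have "\<exists>P. openin S P \<and> (\<forall>R. ched R \<longrightarrow>
         {f \<in> sect (underline S) R. res X R S f x \<in> sect (orbit_cset X q c) R}
           = sect (underline (subtopology S P)) R)"
      by (rule o[unfolded open_orbits_def, rule_format, OF conjI[OF S yoneda[OF S x]] c])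
    then obtain P where P: "openin S P" and eq: "\<And>R. ched R \<Longrightarrow>
         {f \<in> sect (underline S) R. res X R S f x \<in> sect (orbit_cset X q c) R}
           = sect (underline (subtopology S P)) R"
      by blast
    have "res X R S f x \<in> sect (orbit_cset X q c) R \<longleftrightarrow> continuous_map R (subtopology S P) f"
      if "ched R" "continuous_map R S f" "f \<in> extensional (topspace R)" for R f
      using eqset_imp_iff[OF eq[OF that(1)], of f] that(2,3) by (simp add: underline_def)
    then show ?thesis using P by blast
  qed
  have fib: "openin S {s \<in> topspace S. ?f s = c} \<and>
     (\<forall>R. ched R \<longrightarrow> (\<forall>f. continuous_map R S f \<longrightarrow> f \<in> extensional (topspace R) \<longrightarrow>
      continuous_map R (fibre S ?f c) f \<longrightarrow> res X R S f x \<in> sect (orbit_cset X q c) R))"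
    if c: "c \<in> sect Q pt" for c
  proof -
    obtain P where P: "openin S P" and eq: "\<And>R f. ched R \<Longrightarrow> continuous_map R S f
       \<Longrightarrow> f \<in> extensional (topspace R) \<Longrightarrow>
      (res X R S f x \<in> sect (orbit_cset X q c) R \<longleftrightarrow> continuous_map R (subtopology S P) f)"
      using P[OF c] by blast
    have "?f s = c \<longleftrightarrow> s \<in> P" if s: "s \<in> topspace S" for s
    proof -
      let ?s = "restrict (\<lambda>_. s) (topspace (pt :: 'p topology))"
      have cs: "continuous_map pt S ?s"
        by (rule continuous_map_eq[OF continuous_from_pt[OF s]]) simp
      have "res X pt S (\<lambda>_. s) x = res X pt S ?s x"
        by (rule presheaf_res_cong[OF presheaf ched_pt S continuous_from_pt[OF s] x cs]) simp
      then have "?f s = c \<longleftrightarrow> res X pt S ?s x \<in> sect (orbit_cset X q c) pt"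
        using eval_points_Q[OF S x s] presheaf_res_in[OF presheaf ched_pt S cs x]
          res_pt_pt[OF presheaf_Q c] by (simp add: sect_orbit)
      also have "\<dots> \<longleftrightarrow> continuous_map pt (subtopology S P) ?s"
        by (rule eq[OF ched_pt cs]) simp
      also have "\<dots> \<longleftrightarrow> s \<in> P"
        using cs by (auto simp: continuous_map_in_subtopology topspace_pt)
      finally show ?thesis .
    qed
    then have Pe: "{s \<in> topspace S. ?f s = c} = P" using openin_subset[OF P] by blast
    show ?thesis unfolding fibre_def Pe using P eq by blast
  qed
  have cont: "continuous_map S (discrete_topology (sect Q pt)) ?f"
    unfolding continuous_map_discrete_iff
  proof (intro conjI ballI)
    show "?f \<in> topspace S \<rightarrow> sect Q pt"
      using eval_points_Q[OF S x] presheaf_res_in[OF presheaf ched_pt S continuous_from_pt x]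
      by (simp add: sect_Q)
  qed (use fib in blast)
  moreover have "res X (fibre S ?f c) S id x \<in> sect (orbit_cset X q c) (fibre S ?f c)"
    if c: "c \<in> sect Q pt" for c
  proof -
    let ?F = "fibre S ?f c"
    \<comment> \<open>Sections of \<open>C(-, S)\<close> are extensional, so the inclusion of the fibre has to be cut off.\<close>
    let ?i = "restrict id (topspace ?F)"
    have F: "ched ?F" by (rule ched_fibre[OF S cont])
    have i: "continuous_map ?F S ?i" "continuous_map ?F ?F ?i"
      by (rule continuous_map_eq[of _ _ id]; simp)+
    have "res X ?F S ?i x \<in> sect (orbit_cset X q c) ?F"
      using conjunct2[OF fib[OF c]] F i restrict_extensional by blast
    moreover have "res X ?F S id x = res X ?F S ?i x"
      by (rule presheaf_res_cong[OF presheaf F S _ x i(1)]) auto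
    ultimately show ?thesis by simp
  qed
  ultimately show "continuous_map S (discrete_topology (sect Q pt)) ?f \<and>
     (\<forall>c\<in>sect Q pt. res X (fibre S ?f c) S id x \<in> sect (orbit_cset X q c) (fibre S ?f c))"
    by blast
qed

end

text \<open>
  Locality of the relation makes the quotient presheaf separated; it is then a sheaf because
  representatives of classes over two clopen pieces can be glued in \<open>X\<close>.
\<close>

locale local_congruence = congruence X q
  for X :: "('p, 'x) cset" and q +
  assumes condensed: "condensed_set X"
    and q_local: "\<lbrakk>ched S; openin S U; closedin S U; x \<in> sect X S; y \<in> sect X S;
      res X (subtopology S U) S id y \<in> q (subtopology S U) (res X (subtopology S U) S id x);
      res X (subtopology S (topspace S - U)) S id y
        \<in> q (subtopology S (topspace S - U)) (res X (subtopology S (topspace S - U)) S id x)\<rbrakk>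
      \<Longrightarrow> y \<in> q S x"
begin

lemma condensed_Q: "condensed_set Q"
  unfolding condensed_set_def
proof (intro conjI allI impI; (elim conjE)?)
  show "presheaf Q" by (rule presheaf_Q)
  show "\<exists>!c. c \<in> sect Q trivial_topology"
    using condensed_trivial[OF condensed, of trivial_topology] by (auto simp: sect_Q)
  fix S :: "'p topology" and U
  assume S: "ched S" and U: "openin S U" "closedin S U"
  let ?A = "subtopology S U" and ?B = "subtopology S (topspace S - U)"
  have A: "ched ?A" and B: "ched ?B" using ched_subtopology[OF S] U by blast+
  note rA = res_Q[OF A S continuous_sub_id'] and rB = res_Q[OF B S continuous_sub_id']
  note iA = presheaf_res_in[OF presheaf A S continuous_sub_id']
    and iB = presheaf_res_in[OF presheaf B S continuous_sub_id']
  let ?F = "\<lambda>c. (res Q ?A S id c, res Q ?B S id c)"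
  show "bij_betw ?F (sect Q S) (sect Q ?A \<times> sect Q ?B)"
    unfolding bij_betw_def
  proof
    show "inj_on ?F (sect Q S)"
    proof (rule inj_onI)
      fix c d assume "c \<in> sect Q S" "d \<in> sect Q S" and e: "?F c = ?F d"
      then obtain x y where x: "x \<in> sect X S" "c = q S x" and y: "y \<in> sect X S" "d = q S y"
        unfolding sect_Q by blast
      have "q ?A (res X ?A S id x) = q ?A (res X ?A S id y)"
        "q ?B (res X ?B S id x) = q ?B (res X ?B S id y)"
        using e unfolding x(2) y(2) by (simp_all add: rA rB x(1) y(1))
      then have "x \<in> q S y"
        using q_local[OF S U y(1) x(1)] q_refl[OF A iA[OF x(1)]] q_refl[OF B iB[OF x(1)]] by simp
      then show "c = d" using q_eq[OF S y(1)] x(2) y(2) by simp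
    qed
    have "\<exists>x\<in>sect X S. res X ?A S id x = a \<and> res X ?B S id x = b"
      if "a \<in> sect X ?A" "b \<in> sect X ?B" for a b
      using condensed_split[OF condensed S U that] by blast
    then have "\<exists>c\<in>sect Q S. ?F c = (q ?A a, q ?B b)" if "a \<in> sect X ?A" "b \<in> sect X ?B" for a b
      using that rA rB unfolding sect_Q by (smt (verit) image_eqI)
    then have "sect Q ?A \<times> sect Q ?B \<subseteq> ?F ` sect Q S" unfolding sect_Q by force
    moreover have "?F ` sect Q S \<subseteq> sect Q ?A \<times> sect Q ?B"
      using presheaf_res_in[OF presheaf_Q A S] presheaf_res_in[OF presheaf_Q B S] by auto
    ultimately show "?F ` sect Q S = sect Q ?A \<times> sect Q ?B" by blast
  qed
qed

lemma condensed_orbit: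
  assumes c: "c \<in> sect Q pt"
  shows "condensed_set (orbit_cset X q c)"
  unfolding condensed_set_def
proof (intro conjI allI impI; (elim conjE)?)
  let ?O = "orbit_cset X q c"
  have sub: "y \<in> sect X S" if "y \<in> sect ?O S" for y S using that by (simp add: sect_orbit)
  show "presheaf ?O"
    unfolding presheaf_def res_orbit
  proof (intro conjI allI impI ballI; (elim conjE)?)
    show "res X S T f \<in> sect ?O T \<rightarrow> sect ?O S"
      if "ched S" "ched T" "continuous_map S T f" for S T f
      using orbit_res_in[OF that c] by blast
    show "res X S T f y = res X S T g y"
      if "ched S" "ched T" "continuous_map S T f" "continuous_map S T g"
        "\<forall>s\<in>topspace S. f s = g s" "y \<in> sect ?O T" for S T f g y
      using presheaf_res_cong[OF presheaf that(1-3) sub[OF that(6)] that(4)] that(5) by blast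
    show "res X S S id y = y" if "ched S" "y \<in> sect ?O S" for S y
      by (rule presheaf_res_id[OF presheaf that(1) sub[OF that(2)]])
    show "res X R T (g \<circ> f) y = res X R S f (res X S T g y)"
      if "ched R" "ched S" "ched T" "continuous_map R S f" "continuous_map S T g"
        "y \<in> sect ?O T" for R S T f g y
      using presheaf_res_comp[OF presheaf that(2,3,5) sub[OF that(6)] that(1,4)] by simp
  qed
  have cin: "res Q S pt (\<lambda>_. undefined) c \<in> sect Q S" if "ched S" for S
    by (rule presheaf_res_in[OF presheaf_Q that ched_pt continuous_to_pt c])
  have "sect ?O trivial_topology = sect X trivial_topology"
  proof (intro subset_antisym subsetI)
    fix y assume y: "y \<in> sect X trivial_topology"
    then have "q trivial_topology y \<in> sect Q trivial_topology" by (simp add: sect_Q)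
    then have "q trivial_topology y = res Q trivial_topology pt (\<lambda>_. undefined) c"
      using condensed_trivial[OF condensed_Q, of trivial_topology] cin[OF ched_trivial] by auto
    then show "y \<in> sect ?O trivial_topology" using y by (simp add: sect_orbit)
  qed (rule sub)
  then show "\<exists>!x. x \<in> sect ?O trivial_topology"
    using condensed_trivial[OF condensed, of trivial_topology] by simp
  fix S :: "'p topology" and U
  assume S: "ched S" and U: "openin S U" "closedin S U"
  let ?A = "subtopology S U" and ?B = "subtopology S (topspace S - U)"
  have A: "ched ?A" and B: "ched ?B" using ched_subtopology[OF S] U by blast+
  have iA: "continuous_map ?A S id" and iB: "continuous_map ?B S id" by simp_all
  show "bij_betw (\<lambda>x. (res ?O ?A S id x, res ?O ?B S id x)) (sect ?O S) (sect ?O ?A \<times> sect ?O ?B)"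
    unfolding res_orbit
  proof (rule bij_betwI_ex1)
    show "(\<lambda>x. (res X ?A S id x, res X ?B S id x)) \<in> sect ?O S \<rightarrow> sect ?O ?A \<times> sect ?O ?B"
      using orbit_res_in[OF A S iA c] orbit_res_in[OF B S iB c] by blast
    fix p assume "p \<in> sect ?O ?A \<times> sect ?O ?B"
    then obtain a b where p: "p = (a, b)" and a: "a \<in> sect ?O ?A" and b: "b \<in> sect ?O ?B" by blast
    have ex: "\<exists>!x. x \<in> sect X S \<and> res X ?A S id x = a \<and> res X ?B S id x = b"
      by (rule condensed_split[OF condensed S U sub[OF a] sub[OF b]])
    have "x \<in> sect ?O S" if x: "x \<in> sect X S" "res X ?A S id x = a" "res X ?B S id x = b" for x
    proof -
      let ?c = "\<lambda>R. res Q R pt (\<lambda>_. undefined) c"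
      have "\<exists>!w. w \<in> sect Q S \<and> res Q ?A S id w = ?c ?A \<and> res Q ?B S id w = ?c ?B"
        by (rule condensed_split[OF condensed_Q S U cin[OF A] cin[OF B]])
      moreover have "res Q ?A S id (q S x) = ?c ?A" "res Q ?B S id (q S x) = ?c ?B"
        using a b x res_Q[OF A S iA x(1)] res_Q[OF B S iB x(1)] by (simp_all add: sect_orbit)
      moreover have "res Q ?A S id (?c S) = ?c ?A" "res Q ?B S id (?c S) = ?c ?B"
        by (rule res_const[OF A S iA c], rule res_const[OF B S iB c])
      moreover have "q S x \<in> sect Q S" using x by (simp add: sect_Q)
      ultimately have "q S x = ?c S" using cin[OF S] by blast
      then show ?thesis using x by (simp add: sect_orbit)
    qed
    then show "\<exists>!x. x \<in> sect ?O S \<and> (res X ?A S id x, res X ?B S id x) = p"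
      using ex sub unfolding p by blast
  qed
qed

text \<open>
  The classes of \<open>q\<close> are unions of classes of \<open>q'\<close>, so each fibre for \<open>q\<close> is partitioned by the
  fibres for \<open>q'\<close>. On each of these the \<open>q'\<close>-class of \<open>x\<close>, hence its \<open>q\<close>-class, is constant, and
  the constants have the same \<open>q\<close>-class; the sheaf \<open>X/q\<close> then glues these equalities.
\<close>

lemma locally_constant_coarser:
  assumes q': "congruence X q'" and le: "\<And>S x. ched S \<Longrightarrow> x \<in> sect X S \<Longrightarrow> q' S x \<subseteq> q S x"
    and lc: "congruence.locally_constant_classes X q'"
  shows locally_constant_classes
  unfolding locally_constant_classes_def
proof (intro allI impI)
  fix S x assume S: "ched S" and x: "x \<in> sect X S"
  interpret q': congruence X q' by (rule q')
  let ?f = "eval_points Q S (q S x)" and ?g = "eval_points q'.Q S (q' S x)"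
  let ?J = "sect q'.Q pt"
  \<comment> \<open>the map \<open>(X/q')(*) \<rightarrow> (X/q)(*)\<close>; the union has only one member, by \<open>le\<close>\<close>
  define p where "p = (\<lambda>c. \<Union>y\<in>c. q pt y)"
  have p: "p (q' pt y) = q pt y" if y: "y \<in> sect X pt" for y
  proof -
    have "q pt z = q pt y" if "z \<in> q' pt y" for z
      using q_eq[OF ched_pt y] le[OF ched_pt y] that by blast
    then have "p (q' pt y) = (\<Union>z\<in>q' pt y. q pt y)" unfolding p_def by (intro SUP_cong refl)
    also have "\<dots> = q pt y" using q'.q_refl[OF ched_pt y] by blast
    finally show ?thesis .
  qed
  note g = q'.locally_constant_classesD(1)[OF lc S x]
    and gF = q'.locally_constant_classesD(2)[OF lc S x]
  have fg: "?f s = p (?g s)" if "s \<in> topspace S" for s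
    using eval_points_Q[OF S x that] q'.eval_points_Q[OF S x that]
      p presheaf_res_in[OF presheaf ched_pt S continuous_from_pt[OF that] x] by simp
  have "p \<in> ?J \<rightarrow> sect Q pt" using p by (auto simp: q'.sect_Q sect_Q)
  then have "continuous_map S (discrete_topology (sect Q pt)) (p \<circ> ?g)"
    by (intro continuous_map_compose[OF g]) simp
  then have f: "continuous_map S (discrete_topology (sect Q pt)) ?f"
    by (rule continuous_map_eq) (simp add: fg)
  moreover have "res X (fibre S ?f c) S id x \<in> sect (orbit_cset X q c) (fibre S ?f c)"
    if c: "c \<in> sect Q pt" for c
  proof -
    let ?F = "fibre S ?f c"
    have F: "ched ?F" by (rule ched_fibre[OF S f])
    have iF: "continuous_map ?F S id" by simp
    have gF': "continuous_map ?F (discrete_topology ?J) ?g"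
      using continuous_map_compose[OF iF g] by simp
    have xF: "res X ?F S id x \<in> sect X ?F" by (rule presheaf_res_in[OF presheaf F S iF x])
    have wx: "q ?F (res X ?F S id x) \<in> sect Q ?F" using xF by (simp add: sect_Q)
    have wc: "res Q ?F pt (\<lambda>_. undefined) c \<in> sect Q ?F"
      by (rule presheaf_res_in[OF presheaf_Q F ched_pt continuous_to_pt c])
    have "res Q (fibre ?F ?g j) ?F id (q ?F (res X ?F S id x))
        = res Q (fibre ?F ?g j) ?F id (res Q ?F pt (\<lambda>_. undefined) c)" if j: "j \<in> ?J" for j
    proof -
      let ?E = "fibre ?F ?g j" and ?D = "fibre S ?g j"
      have E: "ched ?E" and D: "ched ?D" using ched_fibre[OF F gF'] ched_fibre[OF S g] by auto
      have iE: "continuous_map ?E ?F id" by simp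
      have iED: "continuous_map ?E ?D id" by (rule continuous_fibre_map[OF iF]) simp
      show ?thesis
      proof (cases "topspace ?E = {}")
        case True
        then show ?thesis
          using condensed_trivial[OF condensed_Q True] presheaf_res_in[OF presheaf_Q E F iE]
            wx wc by blast
      next
        case False
        then have pj: "p j = c" using fg by auto
        obtain x0 where x0: "x0 \<in> sect X pt" "j = q' pt x0" using j by (auto simp: q'.sect_Q)
        let ?x = "res X ?E S id x" and ?c = "res X ?E pt (\<lambda>_. undefined) x0"
        have xE: "?x = res X ?E ?D id (res X ?D S id x)" "?x = res X ?E ?F id (res X ?F S id x)"
          using presheaf_res_comp[OF presheaf D S _ x E iED, of id]
            presheaf_res_comp[OF presheaf F S iF x E iE] by simp_all
        have "?x \<in> sect (orbit_cset X q' j) ?E"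
          unfolding xE by (rule q'.orbit_res_in[OF E D iED j gF[OF j]])
        then have xs: "?x \<in> sect X ?E" and "q' ?E ?x = q' ?E ?c"
          using q'.res_Q[OF E ched_pt continuous_to_pt x0(1)] x0(2) by (simp_all add: q'.sect_orbit)
        moreover have cs: "?c \<in> sect X ?E"
          by (rule presheaf_res_in[OF presheaf E ched_pt continuous_to_pt x0(1)])
        ultimately have "?x \<in> q ?E ?c" using q'.q_refl[OF E xs] le[OF E cs] by auto
        then have "q ?E ?x = q ?E ?c" by (rule q_eq[OF E cs])
        also have "\<dots> = res Q ?E pt (\<lambda>_. undefined) c"
          using res_Q[OF E ched_pt continuous_to_pt x0(1)] p[OF x0(1)] pj x0(2) by simp
        finally show ?thesis
          using res_Q[OF E F iE xF] res_const[OF E F iE c] xE(2) by simp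
      qed
    qed
    moreover have "res Q (fibre ?F ?g j) ?F id (res Q ?F pt (\<lambda>_. undefined) c)
        \<in> sect Q (fibre ?F ?g j)" for j
      by (rule presheaf_res_in[OF presheaf_Q ched_fibre[OF F gF'] F _ wc]) simp
    ultimately have "q ?F (res X ?F S id x) = res Q ?F pt (\<lambda>_. undefined) c"
      using condensed_glue[OF condensed_Q F gF',
          of "\<lambda>j. res Q (fibre ?F ?g j) ?F id (res Q ?F pt (\<lambda>_. undefined) c)"] wx wc by blast
    then show ?thesis using xF by (simp add: sect_orbit)
  qed
  ultimately show "continuous_map S (discrete_topology (sect Q pt)) ?f \<and>
     (\<forall>c\<in>sect Q pt. res X (fibre S ?f c) S id x \<in> sect (orbit_cset X q c) (fibre S ?f c))"
    by blast
qed

section \<open>Discreteness of the quotient\<close>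

text \<open>
  Over \<open>S\<close>, the sections \<open>w\<close> of \<open>X/q\<close> inducing a given locally constant function \<open>b\<close> on points are those
  that are constant with value \<open>c\<close> on each fibre \<open>b\<^sup>-\<^sup>1(c)\<close>, and gluing shows that there is
  exactly one of them.
\<close>

lemma discrete_quotient:
  assumes lc: locally_constant_classes
  shows "discrete_cset Q"
  unfolding discrete_cset_def cset_iso_def
proof (intro conjI allI impI)
  let ?I = "sect Q pt"
  let ?U = "underline (discrete_topology ?I)"
  show "condensed_set Q" by (rule condensed_Q)
  have into: "eval_points Q S w \<in> sect ?U S" if S: "ched S" and w: "w \<in> sect Q S" for S w
    using w locally_constant_classesD(1)[OF lc S] by (auto simp: sect_Q underline_def eval_points_def)
  show "cset_hom Q ?U (eval_points Q)"
    unfolding cset_hom_def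
  proof (intro conjI allI impI ballI; (elim conjE)?)
    show "eval_points Q S \<in> sect Q S \<rightarrow> sect ?U S" if "ched S" for S
      using into[OF that] by blast
    fix S T :: "'p topology" and k w
    assume S: "ched S" and T: "ched T" and k: "continuous_map S T k" and w: "w \<in> sect Q T"
    have "res Q pt S (\<lambda>_. s) (res Q S T k w) = res Q pt T (\<lambda>_. k s) w" if "s \<in> topspace S" for s
      using presheaf_res_comp[OF presheaf_Q S T k w ched_pt continuous_from_pt[OF that]]
      by (simp add: comp_def)
    moreover have "k s \<in> topspace T" if "s \<in> topspace S" for s
      using continuous_map_image_subset_topspace[OF k] that by auto
    ultimately show "eval_points Q S (res Q S T k w) = res ?U S T k (eval_points Q T w)"
      by (intro ext) (simp add: eval_points_def underline_def restrict_def)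
  qed
  fix S :: "'p topology" assume S: "ched S"
  show "bij_betw (eval_points Q S) (sect Q S) (sect ?U S)"
  proof (rule bij_betwI_ex1)
    show "eval_points Q S \<in> sect Q S \<rightarrow> sect ?U S" using into[OF S] by blast
    fix b assume "b \<in> sect ?U S"
    then have b: "continuous_map S (discrete_topology ?I) b" and bx: "b \<in> extensional (topspace S)"
      by (auto simp: underline_def)
    let ?c = "\<lambda>c. res Q (fibre S b c) pt (\<lambda>_. undefined) c"
    have F: "ched (fibre S b c)" for c by (rule ched_fibre[OF S b])
    have iff: "eval_points Q S w = b \<longleftrightarrow> (\<forall>c\<in>?I. res Q (fibre S b c) S id w = ?c c)"
      if w: "w \<in> sect Q S" for w
    proof
      assume e: "eval_points Q S w = b"
      obtain x where x: "x \<in> sect X S" "w = q S x" using w by (auto simp: sect_Q)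
      show "\<forall>c\<in>?I. res Q (fibre S b c) S id w = ?c c"
        using locally_constant_classesD(2)[OF lc S x(1)] res_Q[OF F S continuous_fibre_id x(1)]
        unfolding x(2)[symmetric] e by (simp add: sect_orbit x(2))
    next
      assume e: "\<forall>c\<in>?I. res Q (fibre S b c) S id w = ?c c"
      show "eval_points Q S w = b"
      proof (rule extensionalityI[OF _ bx])
        show "eval_points Q S w \<in> extensional (topspace S)" by (simp add: eval_points_def)
        fix s assume s: "s \<in> topspace S"
        then have "b s \<in> ?I" using continuous_map_image_subset_topspace[OF b] by auto
        then show "eval_points Q S w s = b s"
          using eval_points_const[OF S w _ F s refl] e by blast
      qed
    qed
    have "\<exists>!w. w \<in> sect Q S \<and> (\<forall>c\<in>?I. res Q (fibre S b c) S id w = ?c c)"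
      by (rule condensed_glue[OF condensed_Q S b])
        (rule presheaf_res_in[OF presheaf_Q F ched_pt continuous_to_pt])
    then show "\<exists>!w. w \<in> sect Q S \<and> eval_points Q S w = b" using iff by (metis (no_types, lifting))
  qed
qed

section \<open>The decomposition into orbits\<close>

text \<open>
  The map \<open>\<gamma>\<close> is induced by the inclusions of the orbits. For bijectivity, a
  preimage \<open>(f, y)\<close> of \<open>x\<close> must have \<open>f s = [x(s)]\<close>, as \<open>x\<close> lies in the orbit \<open>c\<close> over the fibre of
  \<open>f\<close> at \<open>c\<close>, and \<open>y c\<close> must be the restriction of \<open>x\<close> to this fibre; local constancy says that
  this pair is a section of the coproduct. The last clause, which
  determines \<open>\<gamma>\<close> by gluing, serves to check equivariance.
\<close>

lemma orbit_decomposition: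
  assumes lc: locally_constant_classes
  shows "\<exists>\<gamma>. cset_iso (coprod_cset (sect Q pt) (orbit_cset X q)) X \<gamma> \<and>
    (\<forall>c\<in>sect Q pt. \<forall>S. ched S \<longrightarrow> (\<forall>y\<in>sect (orbit_cset X q c) S.
       \<gamma> S (coprod_inj (sect Q pt) (orbit_cset X q) c S y) = y)) \<and>
    (\<forall>S f y c. ched S \<longrightarrow> (f, y) \<in> sect (coprod_cset (sect Q pt) (orbit_cset X q)) S \<longrightarrow>
       c \<in> sect Q pt \<longrightarrow> res X (fibre S f c) S id (\<gamma> S (f, y)) = y c)"
proof -
  let ?I = "sect Q pt" and ?O = "orbit_cset X q"
  let ?C = "coprod_cset ?I ?O"
  have "cset_hom (?O c) X (\<lambda>_ y. y)" for c
    by (simp add: cset_hom_def orbit_cset_def)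
  then have "\<exists>\<gamma>. cset_hom ?C X \<gamma> \<and>
    (\<forall>c\<in>?I. \<forall>S. ched S \<longrightarrow> (\<forall>y\<in>sect (?O c) S. \<gamma> S (coprod_inj ?I ?O c S y) = y))"
    using coprod_universal_ex[of ?I ?O X "\<lambda>_ _ y. y"] condensed_orbit condensed by blast
  then obtain \<gamma> where hom: "cset_hom ?C X \<gamma>"
    and inj: "\<And>c S y. c \<in> ?I \<Longrightarrow> ched S \<Longrightarrow> y \<in> sect (?O c) S \<Longrightarrow> \<gamma> S (coprod_inj ?I ?O c S y) = y"
    by blast
  have fib: "res X (fibre S f c) S id (\<gamma> S (f, y)) = y c"
    if S: "ched S" and m: "(f, y) \<in> sect ?C S" and c: "c \<in> ?I" for S f y c
  proof -
    have f: "continuous_map S (discrete_topology ?I) f" using m by (simp add: sect_coprod)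
    note F = ched_fibre[OF S f, of c]
    note rf = coprod_restrict_fibre[of ?I ?O, OF condensed_orbit c S m]
    show ?thesis
      using cset_homD(2)[OF hom F S continuous_fibre_id m] rf(2) inj[OF c F rf(1)] by simp
  qed
  have "bij_betw (\<gamma> S) (sect ?C S) (sect X S)" if S: "ched S" for S
  proof (rule bij_betwI_ex1)
    show "\<gamma> S \<in> sect ?C S \<rightarrow> sect X S" using cset_homD(1)[OF hom S] by blast
    fix x assume x: "x \<in> sect X S"
    let ?f = "eval_points Q S (q S x)"
    let ?y = "\<lambda>c\<in>?I. res X (fibre S ?f c) S id x"
    note f = locally_constant_classesD(1)[OF lc S x]
    show "\<exists>!m. m \<in> sect ?C S \<and> \<gamma> S m = x"
    proof (rule ex1I[of _ "(?f, ?y)"])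
      have m: "(?f, ?y) \<in> sect ?C S"
        using f locally_constant_classesD(2)[OF lc S x]
        by (auto simp: sect_coprod eval_points_def)
      have "res X (fibre S ?f c) S id (\<gamma> S (?f, ?y)) = res X (fibre S ?f c) S id x"
        if "c \<in> ?I" for c
        using fib[OF S m that] that by simp
      then have "\<gamma> S (?f, ?y) = x"
        using condensed_glue[OF condensed S f, of "\<lambda>c. res X (fibre S ?f c) S id x"]
          cset_homD(1)[OF hom S m] x
          presheaf_res_in[OF presheaf ched_fibre[OF S f] S continuous_fibre_id x] by blast
      then show "(?f, ?y) \<in> sect ?C S \<and> \<gamma> S (?f, ?y) = x" using m by simp
    next
      fix m assume m0: "m \<in> sect ?C S \<and> \<gamma> S m = x"
      obtain f' y' where me: "m = (f', y')" by (cases m)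
      have m: "(f', y') \<in> sect ?C S" and gx: "\<gamma> S (f', y') = x" using m0 me by auto
      have f': "continuous_map S (discrete_topology ?I) f'" "f' \<in> extensional (topspace S)"
        and y': "y' \<in> (\<Pi>\<^sub>E c\<in>?I. sect (?O c) (fibre S f' c))"
        using m by (simp_all add: sect_coprod)
      have F: "ched (fibre S f' c)" for c by (rule ched_fibre[OF S f'(1)])
      have "?f = f'"
      proof (rule extensionalityI[OF _ f'(2)])
        show "?f \<in> extensional (topspace S)" by (simp add: eval_points_def)
        fix s assume s: "s \<in> topspace S"
        let ?c = "f' s"
        have c: "?c \<in> ?I" using continuous_map_image_subset_topspace[OF f'(1)] s by auto
        have "y' ?c \<in> sect (?O ?c) (fibre S f' ?c)" using y' c by blast
        then have "res Q (fibre S f' ?c) S id (q S x) = res Q (fibre S f' ?c) pt (\<lambda>_. undefined) ?c"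
          using fib[OF S m c] res_Q[OF F S continuous_fibre_id x] gx by (simp add: sect_orbit)
        moreover have "q S x \<in> sect Q S" using x by (simp add: sect_Q)
        ultimately show "?f s = ?c" using eval_points_const[OF S _ c F s refl] by blast
      qed
      moreover have "?y = y'"
        by (rule extensionalityI[of _ ?I])
          (use y' fib[OF S m] gx calculation in \<open>auto simp: PiE_def\<close>)
      ultimately show "m = (?f, ?y)" using me by simp
    qed
  qed
  then show ?thesis using hom inj fib unfolding cset_iso_def by blast
qed

end

section \<open>Orbits of condensed groups\<close>

lemma condensed_groupD:
  assumes "condensed_group G"
  shows condensed_group_condensed: "condensed_set (cset_of_cgroup G)"
    and condensed_group_group: "ched S \<Longrightarrow> group (grp G S)"
    and gres_in: "\<lbrakk>ched S; ched T; continuous_map S T f; g \<in> carrier (grp G T)\<rbrakk>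
      \<Longrightarrow> gres G S T f g \<in> carrier (grp G S)"
proof -
  show "condensed_set (cset_of_cgroup G)" "ched S \<Longrightarrow> group (grp G S)"
    using assms by (simp_all add: condensed_group_def)
  assume a: "ched S" "ched T" "continuous_map S T f" "g \<in> carrier (grp G T)"
  then have "gres G S T f \<in> hom (grp G T) (grp G S)"
    using assms by (simp add: condensed_group_def)
  then show "gres G S T f g \<in> carrier (grp G S)" using a(4) by (rule hom_in_carrier)
qed

lemma left_gsetD:
  assumes "left_gset G X l"
  shows left_condensed: "condensed_set X"
    and left_in: "\<lbrakk>ched S; g \<in> carrier (grp G S); x \<in> sect X S\<rbrakk> \<Longrightarrow> l S g x \<in> sect X S"
    and left_one: "\<lbrakk>ched S; x \<in> sect X S\<rbrakk> \<Longrightarrow> l S \<one>\<^bsub>grp G S\<^esub> x = x"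
    and left_mult: "\<lbrakk>ched S; g \<in> carrier (grp G S); g' \<in> carrier (grp G S); x \<in> sect X S\<rbrakk>
      \<Longrightarrow> l S g (l S g' x) = l S (g \<otimes>\<^bsub>grp G S\<^esub> g') x"
    and left_res: "\<lbrakk>ched S; ched T; continuous_map S T f; g \<in> carrier (grp G T); x \<in> sect X T\<rbrakk>
      \<Longrightarrow> res X S T f (l T g x) = l S (gres G S T f g) (res X S T f x)"
  using assms by (simp_all add: left_gset_def)

lemma right_gsetD:
  assumes "right_gset H X r"
  shows right_in: "\<lbrakk>ched S; h \<in> carrier (grp H S); x \<in> sect X S\<rbrakk> \<Longrightarrow> r S x h \<in> sect X S"
    and right_one: "\<lbrakk>ched S; x \<in> sect X S\<rbrakk> \<Longrightarrow> r S x \<one>\<^bsub>grp H S\<^esub> = x"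
    and right_mult: "\<lbrakk>ched S; h \<in> carrier (grp H S); h' \<in> carrier (grp H S); x \<in> sect X S\<rbrakk>
      \<Longrightarrow> r S (r S x h) h' = r S x (h \<otimes>\<^bsub>grp H S\<^esub> h')"
    and right_res: "\<lbrakk>ched S; ched T; continuous_map S T f; h \<in> carrier (grp H T); x \<in> sect X T\<rbrakk>
      \<Longrightarrow> res X S T f (r T x h) = r S (res X S T f x) (gres H S T f h)"
  using assms by (simp_all add: right_gset_def)

lemma bisetD:
  assumes "biset G H X l r"
  shows biset_left: "left_gset G X l"
    and biset_right: "right_gset H X r"
    and biset_commute: "\<lbrakk>ched S; g \<in> carrier (grp G S); x \<in> sect X S; h \<in> carrier (grp H S)\<rbrakk>
      \<Longrightarrow> r S (l S g x) h = l S g (r S x h)"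
  using assms by (simp_all add: biset_def)

text \<open>By symmetry, one inclusion between the orbits of related elements is enough.\<close>

lemma subset_orbit_eq:
  assumes sub: "\<And>x y. x \<in> A \<Longrightarrow> y \<in> q x \<Longrightarrow> q y \<subseteq> q x"
    and sym: "\<And>x y. x \<in> A \<Longrightarrow> y \<in> q x \<Longrightarrow> y \<in> A \<and> x \<in> q y"
    and "x \<in> A" "y \<in> q x"
  shows "q y = q x"
  using assms by blast

lemma congruence_double_orbit:
  assumes G: "condensed_group G" and H: "condensed_group H" and b: "biset G H X l r"
  shows "congruence X (double_orbit G H l r)"
proof
  let ?q = "double_orbit G H l r"
  note L = left_gsetD[OF biset_left[OF b]] and R = right_gsetD[OF biset_right[OF b]]
  note C = biset_commute[OF b]
  show "presheaf X" by (rule condensed_presheaf[OF L(1)])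
  show refl: "x \<in> ?q S x" if "ched S" "x \<in> sect X S" for S x
  proof -
    interpret g: group "grp G S" by (rule condensed_group_group[OF G that(1)])
    interpret h: group "grp H S" by (rule condensed_group_group[OF H that(1)])
    have "x = r S (l S \<one>\<^bsub>grp G S\<^esub> x) \<one>\<^bsub>grp H S\<^esub>" using L(3)[OF that] R(2)[OF that] by simp
    then show ?thesis unfolding double_orbit_def using g.one_closed h.one_closed by blast
  qed
  show sec: "y \<in> sect X S" if "ched S" "x \<in> sect X S" "y \<in> ?q S x" for S x y
    using that L(2) R(1) by (auto simp: double_orbit_def)
  have comp: "r S (l S g' (r S (l S g x) h)) h' = r S (l S (g' \<otimes>\<^bsub>grp G S\<^esub> g) x) (h \<otimes>\<^bsub>grp H S\<^esub> h')"
    if S: "ched S" and x: "x \<in> sect X S" and g: "g \<in> carrier (grp G S)" "g' \<in> carrier (grp G S)"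
      and h: "h \<in> carrier (grp H S)" "h' \<in> carrier (grp H S)" for S x g g' h h'
  proof -
    have gx: "l S g x \<in> sect X S" by (rule L(2)[OF S g(1) x])
    have "l S g' (r S (l S g x) h) = r S (l S (g' \<otimes>\<^bsub>grp G S\<^esub> g) x) h"
      using C[OF S g(2) gx h(1)] L(4)[OF S g(2,1) x] by simp
    moreover have "l S (g' \<otimes>\<^bsub>grp G S\<^esub> g) x \<in> sect X S"
      using L(4)[OF S g(2,1) x] L(2)[OF S g(2) gx] by simp
    ultimately show ?thesis using R(3)[OF S h] by simp
  qed
  show "?q S y = ?q S x" if S: "ched S" and x: "x \<in> sect X S" and y: "y \<in> ?q S x" for S x y
  proof (rule subset_orbit_eq[of "sect X S" "?q S", OF _ _ x y])
    interpret g: group "grp G S" by (rule condensed_group_group[OF G S])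
    interpret h: group "grp H S" by (rule condensed_group_group[OF H S])
    fix x y assume x: "x \<in> sect X S" and "y \<in> ?q S x"
    then obtain g h where g: "g \<in> carrier (grp G S)" and h: "h \<in> carrier (grp H S)"
      and y: "y = r S (l S g x) h" by (auto simp: double_orbit_def)
    show "?q S y \<subseteq> ?q S x"
      using comp[OF S x g _ h] g.m_closed[OF _ g] h.m_closed[OF h]
      by (auto simp: double_orbit_def y) blast
    have "r S (l S (inv\<^bsub>grp G S\<^esub> g) y) (inv\<^bsub>grp H S\<^esub> h) = x"
      using comp[OF S x g _ h] L(3)[OF S x] R(2)[OF S x] g h by (simp add: y)
    then have "x \<in> ?q S y"
      unfolding double_orbit_def using g.inv_closed[OF g] h.inv_closed[OF h] by blast
    then show "y \<in> sect X S \<and> x \<in> ?q S y" using L(2)[OF S g x] R(1)[OF S h] y by simp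
  qed
  show "res X S T f y \<in> ?q S (res X S T f x)"
    if a: "ched S" "ched T" "continuous_map S T f" and x: "x \<in> sect X T" and y: "y \<in> ?q T x"
    for S T f x y
  proof -
    obtain g h where g: "g \<in> carrier (grp G T)" and h: "h \<in> carrier (grp H T)"
      and y: "y = r T (l T g x) h" using y by (auto simp: double_orbit_def)
    have "res X S T f y = r S (l S (gres G S T f g) (res X S T f x)) (gres H S T f h)"
      using R(4)[OF a h L(2)[OF a(2) g x]] L(5)[OF a g x] y by simp
    then show ?thesis
      unfolding double_orbit_def using gres_in[OF G a g] gres_in[OF H a h] by blast
  qed
qed

text \<open>
  The group elements relating \<open>x\<close> to \<open>y\<close> over the two pieces glue, as \<open>G\<close> and \<open>H\<close> are sheaves.
\<close>

lemma local_congruence_double_orbit: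
  fixes X :: "('p, 'x) cset"
  assumes G: "condensed_group G" and H: "condensed_group H" and b: "biset G H X l r"
  shows "local_congruence X (double_orbit G H l r)"
proof -
  let ?q = "double_orbit G H l r"
  note L = left_gsetD[OF biset_left[OF b]] and R = right_gsetD[OF biset_right[OF b]]
  interpret congruence X ?q by (rule congruence_double_orbit[OF assms])
  show ?thesis
  proof
    show "condensed_set X" by (rule L(1))
    fix S :: "'p topology" and U x y
    let ?A = "subtopology S U" and ?B = "subtopology S (topspace S - U)"
    assume S: "ched S" and U: "openin S U" "closedin S U" and x: "x \<in> sect X S"
      and y: "y \<in> sect X S" and yA: "res X ?A S id y \<in> ?q ?A (res X ?A S id x)"
      and yB: "res X ?B S id y \<in> ?q ?B (res X ?B S id x)"
    have A: "ched ?A" and B: "ched ?B" using ched_subtopology[OF S] U by blast+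
    have iA: "continuous_map ?A S id" and iB: "continuous_map ?B S id" by simp_all
    obtain gA hA where gA: "gA \<in> carrier (grp G ?A)" and hA: "hA \<in> carrier (grp H ?A)"
      and eA: "res X ?A S id y = r ?A (l ?A gA (res X ?A S id x)) hA"
      using yA by (auto simp: double_orbit_def)
    obtain gB hB where gB: "gB \<in> carrier (grp G ?B)" and hB: "hB \<in> carrier (grp H ?B)"
      and eB: "res X ?B S id y = r ?B (l ?B gB (res X ?B S id x)) hB"
      using yB by (auto simp: double_orbit_def)
    obtain g where g: "g \<in> carrier (grp G S)" "gres G ?A S id g = gA" "gres G ?B S id g = gB"
      using condensed_split[OF condensed_group_condensed[OF G] S U, of gA gB] gA gB
      by (auto simp: cset_of_cgroup_def)
    obtain h where h: "h \<in> carrier (grp H S)" "gres H ?A S id h = hA" "gres H ?B S id h = hB"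
      using condensed_split[OF condensed_group_condensed[OF H] S U, of hA hB] hA hB
      by (auto simp: cset_of_cgroup_def)
    let ?z = "r S (l S g x) h"
    have gx: "l S g x \<in> sect X S" by (rule L(2)[OF S g(1) x])
    have z: "?z \<in> sect X S" by (rule R(1)[OF S h(1) gx])
    have "res X ?A S id ?z = res X ?A S id y" "res X ?B S id ?z = res X ?B S id y"
      using R(4)[OF A S iA h(1) gx] L(5)[OF A S iA g(1) x] R(4)[OF B S iB h(1) gx]
        L(5)[OF B S iB g(1) x] g h eA eB by simp_all
    then have "?z = y"
      using condensed_split[OF L(1) S U presheaf_res_in[OF presheaf A S iA y]
          presheaf_res_in[OF presheaf B S iB y]] y z by blast
    then show "y \<in> ?q S x" unfolding double_orbit_def using g h by blast
  qed
qed

lemma congruence_left_orbit: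
  assumes G: "condensed_group G" and X: "left_gset G X l"
  shows "congruence X (left_orbit G l)"
proof
  let ?q = "left_orbit G l"
  note L = left_gsetD[OF X]
  show "presheaf X" by (rule condensed_presheaf[OF L(1)])
  show "x \<in> ?q S x" if "ched S" "x \<in> sect X S" for S x
    using L(3)[OF that] group.is_monoid[OF condensed_group_group[OF G that(1)]]
    unfolding left_orbit_def by (metis (mono_tags, lifting) mem_Collect_eq monoid.one_closed)
  show "y \<in> sect X S" if "ched S" "x \<in> sect X S" "y \<in> ?q S x" for S x y
    using that L(2) by (auto simp: left_orbit_def)
  show "?q S y = ?q S x" if S: "ched S" and x: "x \<in> sect X S" and y: "y \<in> ?q S x" for S x y
  proof (rule subset_orbit_eq[of "sect X S" "?q S", OF _ _ x y])
    interpret g: group "grp G S" by (rule condensed_group_group[OF G S])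
    fix x y assume x: "x \<in> sect X S" and "y \<in> ?q S x"
    then obtain g where g: "g \<in> carrier (grp G S)" and y: "y = l S g x"
      by (auto simp: left_orbit_def)
    show "?q S y \<subseteq> ?q S x"
      using L(4)[OF S _ g x] g.m_closed[OF _ g] by (auto simp: left_orbit_def y)
    have "l S (inv\<^bsub>grp G S\<^esub> g) y = x"
      using L(4)[OF S g.inv_closed[OF g] g x] L(3)[OF S x] g by (simp add: y)
    then have "x \<in> ?q S y" unfolding left_orbit_def using g.inv_closed[OF g] by blast
    then show "y \<in> sect X S \<and> x \<in> ?q S y" using L(2)[OF S g x] y by simp
  qed
  show "res X S T f y \<in> ?q S (res X S T f x)"
    if a: "ched S" "ched T" "continuous_map S T f" and x: "x \<in> sect X T" and y: "y \<in> ?q T x"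
    for S T f x y
    using y L(5)[OF a _ x] gres_in[OF G a] by (auto simp: left_orbit_def)
qed

lemma congruence_right_orbit:
  assumes H: "condensed_group H" and X: "right_gset H X r"
  shows "congruence X (right_orbit H r)"
proof
  let ?q = "right_orbit H r"
  note R = right_gsetD[OF X]
  show "presheaf X" using X by (simp add: right_gset_def condensed_presheaf)
  show "x \<in> ?q S x" if "ched S" "x \<in> sect X S" for S x
    using R(2)[OF that] group.is_monoid[OF condensed_group_group[OF H that(1)]]
    unfolding right_orbit_def by (metis (mono_tags, lifting) mem_Collect_eq monoid.one_closed)
  show "y \<in> sect X S" if "ched S" "x \<in> sect X S" "y \<in> ?q S x" for S x y
    using that R(1) by (auto simp: right_orbit_def)
  show "?q S y = ?q S x" if S: "ched S" and x: "x \<in> sect X S" and y: "y \<in> ?q S x" for S x y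
  proof (rule subset_orbit_eq[of "sect X S" "?q S", OF _ _ x y])
    interpret h: group "grp H S" by (rule condensed_group_group[OF H S])
    fix x y assume x: "x \<in> sect X S" and "y \<in> ?q S x"
    then obtain h where h: "h \<in> carrier (grp H S)" and y: "y = r S x h"
      by (auto simp: right_orbit_def)
    show "?q S y \<subseteq> ?q S x"
      using R(3)[OF S h _ x] h.m_closed[OF h] by (auto simp: right_orbit_def y)
    have "r S y (inv\<^bsub>grp H S\<^esub> h) = x"
      using R(3)[OF S h h.inv_closed[OF h] x] R(2)[OF S x] h by (simp add: y)
    then have "x \<in> ?q S y" unfolding right_orbit_def using h.inv_closed[OF h] by blast
    then show "y \<in> sect X S \<and> x \<in> ?q S y" using R(1)[OF S h x] y by simp
  qed
  show "res X S T f y \<in> ?q S (res X S T f x)"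
    if a: "ched S" "ched T" "continuous_map S T f" and x: "x \<in> sect X T" and y: "y \<in> ?q T x"
    for S T f x y
    using y R(4)[OF a _ x] gres_in[OF H a] by (auto simp: right_orbit_def)
qed

lemma left_orbit_sub_double:
  assumes H: "condensed_group H" and b: "biset G H X l r" and S: "ched S" and x: "x \<in> sect X S"
  shows "left_orbit G l S x \<subseteq> double_orbit G H l r S x"
proof
  interpret h: group "grp H S" by (rule condensed_group_group[OF H S])
  fix y assume "y \<in> left_orbit G l S x"
  then obtain g where g: "g \<in> carrier (grp G S)" "y = l S g x" by (auto simp: left_orbit_def)
  then have "y = r S (l S g x) \<one>\<^bsub>grp H S\<^esub>"
    using right_one[OF biset_right[OF b] S] left_in[OF biset_left[OF b] S _ x] by simp
  then show "y \<in> double_orbit G H l r S x"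
    unfolding double_orbit_def using g h.one_closed by blast
qed

lemma right_orbit_sub_double:
  assumes G: "condensed_group G" and b: "biset G H X l r" and S: "ched S" and x: "x \<in> sect X S"
  shows "right_orbit H r S x \<subseteq> double_orbit G H l r S x"
proof
  interpret g: group "grp G S" by (rule condensed_group_group[OF G S])
  fix y assume "y \<in> right_orbit H r S x"
  then obtain h where h: "h \<in> carrier (grp H S)" "y = r S x h" by (auto simp: right_orbit_def)
  then have "y = r S (l S \<one>\<^bsub>grp G S\<^esub> x) h"
    using left_one[OF biset_left[OF b] S x] by simp
  then show "y \<in> double_orbit G H l r S x"
    unfolding double_orbit_def using h g.one_closed by blast
qed

lemma double_classes_locally_constant:
  assumes G: "condensed_group G" and H: "condensed_group H" and b: "biset G H X l r"
    and o: "open_left_action G X l \<or> open_right_action H X r"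
  shows "congruence.locally_constant_classes X (double_orbit G H l r)"
proof -
  interpret local_congruence X "double_orbit G H l r"
    by (rule local_congruence_double_orbit[OF G H b])
  show ?thesis using o
  proof
    assume "open_left_action G X l"
    then show ?thesis
      using locally_constant_coarser[OF congruence_left_orbit[OF G biset_left[OF b]]]
        left_orbit_sub_double[OF H b]
        congruence.open_orbits_locally_constant[OF congruence_left_orbit[OF G biset_left[OF b]]]
      unfolding open_left_action_def by blast
  next
    assume "open_right_action H X r"
    then show ?thesis
      using locally_constant_coarser[OF congruence_right_orbit[OF H biset_right[OF b]]]
        right_orbit_sub_double[OF G b]
        congruence.open_orbits_locally_constant[OF congruence_right_orbit[OF H biset_right[OF b]]]
      unfolding open_right_action_def by blast
  qed
qed

section \<open>Transport of biset structures\<close>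

lemma cset_iso_inverse:
  assumes X: "presheaf X" and Y: "presheaf Y" and iso: "cset_iso Y X \<gamma>"
  shows "cset_iso X Y (\<lambda>S. inv_into (sect Y S) (\<gamma> S))"
proof -
  have hom: "cset_hom Y X \<gamma>" and bij: "\<And>S. ched S \<Longrightarrow> bij_betw (\<gamma> S) (sect Y S) (sect X S)"
    using iso by (auto simp: cset_iso_def)
  let ?i = "\<lambda>S. inv_into (sect Y S) (\<gamma> S)"
  have ibij: "bij_betw (?i S) (sect X S) (sect Y S)" if "ched S" for S
    by (rule bij_betw_inv_into[OF bij[OF that]])
  have "?i S (res X S T f x) = res Y S T f (?i T x)"
    if a: "ched S" "ched T" "continuous_map S T f" and x: "x \<in> sect X T" for S T f x
  proof -
    have y: "?i T x \<in> sect Y T" using bij_betwE[OF ibij[OF a(2)]] x by blast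
    have "\<gamma> S (res Y S T f (?i T x)) = res X S T f x"
      using cset_homD(2)[OF hom a y] bij_betw_inv_into_right[OF bij[OF a(2)] x] by simp
    then show ?thesis
      using bij_betw_inv_into_left[OF bij[OF a(1)] presheaf_res_in[OF Y a y]] by simp
  qed
  then show ?thesis using ibij bij_betwE[OF ibij] by (auto simp: cset_iso_def cset_hom_def)
qed

text \<open>
  Operations on \<open>Y\<close> that correspond to the actions on \<open>X\<close> under a bijection satisfy the same
  laws. For the coproduct this replaces a verification of the biset axioms fibre by fibre.
\<close>

lemma biset_iso_transport:
  fixes X :: "('p, 'x) cset"
  assumes G: "condensed_group G" and H: "condensed_group H" and b: "biset G H X l r"
    and Y: "condensed_set Y" and iso: "cset_iso Y X \<gamma>"
    and l'_in: "\<And>S g y. \<lbrakk>ched S; g \<in> carrier (grp G S); y \<in> sect Y S\<rbrakk> \<Longrightarrow> l' S g y \<in> sect Y S"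
    and r'_in: "\<And>S h y. \<lbrakk>ched S; h \<in> carrier (grp H S); y \<in> sect Y S\<rbrakk> \<Longrightarrow> r' S y h \<in> sect Y S"
    and l'_eq: "\<And>S g y. \<lbrakk>ched S; g \<in> carrier (grp G S); y \<in> sect Y S\<rbrakk>
      \<Longrightarrow> \<gamma> S (l' S g y) = l S g (\<gamma> S y)"
    and r'_eq: "\<And>S h y. \<lbrakk>ched S; h \<in> carrier (grp H S); y \<in> sect Y S\<rbrakk>
      \<Longrightarrow> \<gamma> S (r' S y h) = r S (\<gamma> S y) h"
  shows "biset_iso G H X l r Y l' r' (\<lambda>S. inv_into (sect Y S) (\<gamma> S))"
proof -
  note L = left_gsetD[OF biset_left[OF b]] and R = right_gsetD[OF biset_right[OF b]]
  have hom: "cset_hom Y X \<gamma>" and bij: "\<And>S. ched S \<Longrightarrow> bij_betw (\<gamma> S) (sect Y S) (sect X S)"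
    using iso by (auto simp: cset_iso_def)
  note P = condensed_presheaf[OF Y]
  have eqI: "y = z" if "ched S" "y \<in> sect Y S" "z \<in> sect Y S" "\<gamma> S y = \<gamma> S z" for S y z
    using bij_betw_imp_inj_on[OF bij[OF that(1)]] that(2-4) by (auto dest: inj_onD)
  note g_in = cset_homD(1)[OF hom] and g_res = cset_homD(2)[OF hom]
  have "left_gset G Y l'"
    unfolding left_gset_def
  proof (intro conjI allI impI ballI; (elim conjE)?)
    fix S :: "'p topology" assume S: "ched S"
    interpret g: group "grp G S" by (rule condensed_group_group[OF G S])
    fix y assume y: "y \<in> sect Y S"
    show "l' S \<one>\<^bsub>grp G S\<^esub> y = y"
      by (rule eqI[OF S l'_in[OF S g.one_closed y] y])
        (simp add: l'_eq[OF S g.one_closed y] L(3)[OF S g_in[OF S y]])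
    fix g g' assume g: "g \<in> carrier (grp G S)" and g': "g' \<in> carrier (grp G S)"
    show "l' S (g \<otimes>\<^bsub>grp G S\<^esub> g') y = l' S g (l' S g' y)"
      by (rule eqI[OF S l'_in[OF S g.m_closed[OF g g'] y] l'_in[OF S g l'_in[OF S g' y]]])
        (simp add: l'_eq[OF S] g g' y l'_in[OF S] L(4)[OF S g g' g_in[OF S y]])
  next
    fix S T :: "'p topology" and f g y
    assume a: "ched S" "ched T" "continuous_map S T f"
      and g: "g \<in> carrier (grp G T)" and y: "y \<in> sect Y T"
    note gr = gres_in[OF G a g] and yr = presheaf_res_in[OF P a y]
    show "res Y S T f (l' T g y) = l' S (gres G S T f g) (res Y S T f y)"
      by (rule eqI[OF a(1) presheaf_res_in[OF P a l'_in[OF a(2) g y]] l'_in[OF a(1) gr yr]])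
        (simp add: g_res[OF a l'_in[OF a(2) g y]] l'_eq[OF a(2) g y] l'_eq[OF a(1) gr yr]
          g_res[OF a y] L(5)[OF a g g_in[OF a(2) y]])
  qed (use Y l'_in in auto)
  moreover have "right_gset H Y r'"
    unfolding right_gset_def
  proof (intro conjI allI impI ballI; (elim conjE)?)
    fix S :: "'p topology" assume S: "ched S"
    interpret h: group "grp H S" by (rule condensed_group_group[OF H S])
    fix y assume y: "y \<in> sect Y S"
    show "r' S y \<one>\<^bsub>grp H S\<^esub> = y"
      by (rule eqI[OF S r'_in[OF S h.one_closed y] y])
        (simp add: r'_eq[OF S h.one_closed y] R(2)[OF S g_in[OF S y]])
    fix h h' assume h: "h \<in> carrier (grp H S)" and h': "h' \<in> carrier (grp H S)"
    show "r' S y (h \<otimes>\<^bsub>grp H S\<^esub> h') = r' S (r' S y h) h'"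
      by (rule eqI[OF S r'_in[OF S h.m_closed[OF h h'] y] r'_in[OF S h' r'_in[OF S h y]]])
        (simp add: r'_eq[OF S] h h' y r'_in[OF S] R(3)[OF S h h' g_in[OF S y]])
  next
    fix S T :: "'p topology" and f h y
    assume a: "ched S" "ched T" "continuous_map S T f"
      and h: "h \<in> carrier (grp H T)" and y: "y \<in> sect Y T"
    note hr = gres_in[OF H a h] and yr = presheaf_res_in[OF P a y]
    show "res Y S T f (r' T y h) = r' S (res Y S T f y) (gres H S T f h)"
      by (rule eqI[OF a(1) presheaf_res_in[OF P a r'_in[OF a(2) h y]] r'_in[OF a(1) hr yr]])
        (simp add: g_res[OF a r'_in[OF a(2) h y]] r'_eq[OF a(2) h y] r'_eq[OF a(1) hr yr]
          g_res[OF a y] R(4)[OF a h g_in[OF a(2) y]])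
  qed (use Y r'_in in auto)
  moreover have "r' S (l' S g y) h = l' S g (r' S y h)"
    if S: "ched S" and g: "g \<in> carrier (grp G S)" and y: "y \<in> sect Y S" and h: "h \<in> carrier (grp H S)"
    for S g y h
    by (rule eqI[OF S r'_in[OF S h l'_in[OF S g y]] l'_in[OF S g r'_in[OF S h y]]])
      (simp add: l'_eq[OF S] r'_eq[OF S] l'_in[OF S] r'_in[OF S] g h y
        biset_commute[OF b S g g_in[OF S y] h])
  ultimately have bY: "biset G H Y l' r'" by (simp add: biset_def)
  let ?i = "\<lambda>S. inv_into (sect Y S) (\<gamma> S)"
  have i_in: "?i S x \<in> sect Y S" and gi: "\<gamma> S (?i S x) = x" if "ched S" "x \<in> sect X S" for S x
    using bij_betwE[OF bij_betw_inv_into[OF bij[OF that(1)]]]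
      bij_betw_inv_into_right[OF bij[OF that(1)]] that(2) by blast+
  have "?i S (l S g x) = l' S g (?i S x)"
    if S: "ched S" and g: "g \<in> carrier (grp G S)" and x: "x \<in> sect X S" for S g x
    by (rule eqI[OF S i_in[OF S L(2)[OF S g x]] l'_in[OF S g i_in[OF S x]]])
      (simp add: gi[OF S] L(2)[OF S g x] x l'_eq[OF S g i_in[OF S x]])
  moreover have "?i S (r S x h) = r' S (?i S x) h"
    if S: "ched S" and h: "h \<in> carrier (grp H S)" and x: "x \<in> sect X S" for S h x
    by (rule eqI[OF S i_in[OF S R(1)[OF S h x]] r'_in[OF S h i_in[OF S x]]])
      (simp add: gi[OF S] R(1)[OF S h x] x r'_eq[OF S h i_in[OF S x]])
  ultimately show ?thesis
    using b bY cset_iso_inverse[OF condensed_presheaf[OF L(1)] P iso] by (simp add: biset_iso_def)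
qed

theorem proposition4p7:
  fixes G :: "('p, 'g) cgroup" and H :: "('p, 'h) cgroup" and X :: "('p, 'x) cset"
    and l :: "'p topology \<Rightarrow> 'g \<Rightarrow> 'x \<Rightarrow> 'x" and r :: "'p topology \<Rightarrow> 'x \<Rightarrow> 'h \<Rightarrow> 'x"
  assumes "condensed_group G" and "condensed_group H"
    and "biset G H X l r"
    and "open_left_action G X l \<or> open_right_action H X r"
  shows "discrete_cset (double_quotient G H X l r) \<and>
    (let I = sect (double_quotient G H X l r) pt;
         GxH = orbit_cset X (double_orbit G H l r)
     in \<exists>\<phi>. biset_iso G H X l r (coprod_cset I GxH) (coprod_left I G l) (coprod_right I H r) \<phi> \<and>
          (\<forall>x\<in>I. \<forall>S. ched S \<longrightarrow>
             (\<forall>y\<in>sect (GxH x) S. \<phi> S y = coprod_inj I GxH x S y)))"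
proof -
  note G = assms(1) and H = assms(2) and b = assms(3)
  let ?q = "double_orbit G H l r"
  interpret local_congruence X ?q by (rule local_congruence_double_orbit[OF G H b])
  note lc = double_classes_locally_constant[OF assms]
  note L = left_gsetD[OF biset_left[OF b]] and R = right_gsetD[OF biset_right[OF b]]
  let ?I = "sect Q pt" and ?O = "orbit_cset X ?q"
  let ?C = "coprod_cset ?I ?O" and ?l = "coprod_left ?I G l" and ?r = "coprod_right ?I H r"
  obtain \<gamma> where iso: "cset_iso ?C X \<gamma>"
    and inj: "\<And>c S y. c \<in> ?I \<Longrightarrow> ched S \<Longrightarrow> y \<in> sect (?O c) S \<Longrightarrow> \<gamma> S (coprod_inj ?I ?O c S y) = y"
    and fib: "\<And>S f y c. ched S \<Longrightarrow> (f, y) \<in> sect ?C S \<Longrightarrow> c \<in> ?I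
      \<Longrightarrow> res X (fibre S f c) S id (\<gamma> S (f, y)) = y c"
    using orbit_decomposition[OF lc] by blast
  have hom: "cset_hom ?C X \<gamma>" and bij: "\<And>S. ched S \<Longrightarrow> bij_betw (\<gamma> S) (sect ?C S) (sect X S)"
    using iso by (auto simp: cset_iso_def)
  have C: "condensed_set ?C" by (rule condensed_coprod) (rule condensed_orbit)
  \<comment> \<open>Sections of \<open>X\<close> that agree on the fibres of a locally constant function are equal.\<close>
  have eqI: "x = z" if S: "ched S" and f: "continuous_map S (discrete_topology ?I) f"
    and x: "x \<in> sect X S" and z: "z \<in> sect X S"
    and e: "\<And>c. c \<in> ?I \<Longrightarrow> res X (fibre S f c) S id x = res X (fibre S f c) S id z" for S f x z
    using condensed_glue[OF condensed S f, of "\<lambda>c. res X (fibre S f c) S id z"] x z e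
      presheaf_res_in[OF presheaf ched_fibre[OF S f] S continuous_fibre_id z] by blast
  have orb: "z \<in> sect (?O c) S" if "ched S" "y \<in> sect (?O c) S" "z \<in> ?q S y" for S y z c
    using q_eq[OF that(1) _ that(3)] q_sect[OF that(1) _ that(3)] that(2) by (simp add: sect_orbit)
  have l: "?l S g m \<in> sect ?C S \<and> \<gamma> S (?l S g m) = l S g (\<gamma> S m)"
    if S: "ched S" and g: "g \<in> carrier (grp G S)" and m: "m \<in> sect ?C S" for S g m
  proof -
    obtain f y where me: "m = (f, y)" by (cases m)
    note m = m[unfolded me]
    have f: "continuous_map S (discrete_topology ?I) f" "f \<in> extensional (topspace S)"
      and y: "\<And>c. c \<in> ?I \<Longrightarrow> y c \<in> sect (?O c) (fibre S f c)"
      using m by (auto simp: sect_coprod)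
    note F = ched_fibre[OF S f(1)]
    note gr = gres_in[OF G F S continuous_fibre_id g]
    have "l (fibre S f c) (gres G (fibre S f c) S id g) (y c) \<in> sect (?O c) (fibre S f c)"
      if c: "c \<in> ?I" for c
    proof (rule orb[OF F y[OF c]])
      show "l (fibre S f c) (gres G (fibre S f c) S id g) (y c) \<in> ?q (fibre S f c) (y c)"
        using left_orbit_sub_double[OF H b F, of "y c"] y[OF c] gr
        by (fastforce simp: left_orbit_def sect_orbit)
    qed
    then have lm: "(f, \<lambda>c\<in>?I. l (fibre S f c) (gres G (fibre S f c) S id g) (y c)) \<in> sect ?C S"
      using f by (auto simp: sect_coprod)
    have gm: "\<gamma> S (f, y) \<in> sect X S" by (rule cset_homD(1)[OF hom S m])
    show ?thesis
      using lm eqI[OF S f(1) cset_homD(1)[OF hom S lm] L(2)[OF S g gm]]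
      by (simp add: me coprod_left_def fib[OF S lm] fib[OF S m]
          L(5)[OF F S continuous_fibre_id g gm])
  qed
  have r: "?r S m h \<in> sect ?C S \<and> \<gamma> S (?r S m h) = r S (\<gamma> S m) h"
    if S: "ched S" and h: "h \<in> carrier (grp H S)" and m: "m \<in> sect ?C S" for S h m
  proof -
    obtain f y where me: "m = (f, y)" by (cases m)
    note m = m[unfolded me]
    have f: "continuous_map S (discrete_topology ?I) f" "f \<in> extensional (topspace S)"
      and y: "\<And>c. c \<in> ?I \<Longrightarrow> y c \<in> sect (?O c) (fibre S f c)"
      using m by (auto simp: sect_coprod)
    note F = ched_fibre[OF S f(1)]
    note hr = gres_in[OF H F S continuous_fibre_id h]
    have "r (fibre S f c) (y c) (gres H (fibre S f c) S id h) \<in> sect (?O c) (fibre S f c)"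
      if c: "c \<in> ?I" for c
    proof (rule orb[OF F y[OF c]])
      show "r (fibre S f c) (y c) (gres H (fibre S f c) S id h) \<in> ?q (fibre S f c) (y c)"
        using right_orbit_sub_double[OF G b F, of "y c"] y[OF c] hr
        by (fastforce simp: right_orbit_def sect_orbit)
    qed
    then have rm: "(f, \<lambda>c\<in>?I. r (fibre S f c) (y c) (gres H (fibre S f c) S id h)) \<in> sect ?C S"
      using f by (auto simp: sect_coprod)
    have gm: "\<gamma> S (f, y) \<in> sect X S" by (rule cset_homD(1)[OF hom S m])
    show ?thesis
      using rm eqI[OF S f(1) cset_homD(1)[OF hom S rm] R(1)[OF S h gm]]
      by (simp add: me coprod_right_def fib[OF S rm] fib[OF S m]
          R(4)[OF F S continuous_fibre_id h gm])
  qed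
  let ?\<phi> = "\<lambda>S. inv_into (sect ?C S) (\<gamma> S)"
  have "biset_iso G H X l r ?C ?l ?r ?\<phi>"
    by (rule biset_iso_transport[OF G H b C iso]) (use l r in blast)+
  moreover have "?\<phi> S y = coprod_inj ?I ?O c S y"
    if c: "c \<in> ?I" and S: "ched S" and y: "y \<in> sect (?O c) S" for c S y
    using bij_betw_inv_into_left[OF bij[OF S] coprod_inj_in(1)[of ?I ?O, OF condensed_orbit c S y]]
      inj[OF c S y] by simp
  ultimately show ?thesis
    using discrete_quotient[OF lc] unfolding Let_def by blast
qed

end
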